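(* Let $H_0$ be the Hankel operator in $L^2(\mathbb{R}_+)$ with kernel $h_0(t)=t^{-1}$ (the Carleman operator). If $V$ is a self-adjoint Hankel operator of finite rank in $L^2(\mathbb{R}_+)$ and $H=H_0+V$, then $$N_-(H)=N_-(V).$$ In particular, $H\ge 0$ if and only if $V\ge 0$.
   Context: A Hankel operator in $L^2(\mathbb{R}_+)$, $\mathbb{R}_+=(0,\infty)$, with kernel $h$ is the operator $(Hf)(t)=\int_0^\infty h(t+s)f(s)\,ds$; the Carleman operator $(H_0f)(t)=\int_0^\infty (t+s)^{-1}f(s)\,ds$ is bounded and self-adjoint. For a self-adjoint operator $A$, $N_-(A)$ denotes the total multiplicity of its strictly negative spectrum. *)

theory Defs
  imports "HOL-Analysis.Analysis"
begin

section \<open>The complex Hilbert space of square-integrable functions on the half-line\<close>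

abbreviation halfline :: "real measure" where
  "halfline \<equiv> restrict_space lborel {0<..}"

definition square_integrable :: "(real \<Rightarrow> complex) \<Rightarrow> bool" where
  "square_integrable f \<longleftrightarrow>
     f \<in> borel_measurable halfline \<and> integrable halfline (\<lambda>t. (cmod (f t))\<^sup>2)"

definition ae_eq :: "(real \<Rightarrow> complex) \<Rightarrow> (real \<Rightarrow> complex) \<Rightarrow> bool" where
  "ae_eq f g \<longleftrightarrow>
     square_integrable f \<and> square_integrable g \<and> (AE t in halfline. f t = g t)"

lemma square_integrable_0: "square_integrable (\<lambda>t. 0)"
  by (simp add: square_integrable_def)

lemma square_integrable_scale:
  "square_integrable f \<Longrightarrow> square_integrable (\<lambda>t. c * f t)"
  by (auto simp: square_integrable_def norm_mult power_mult_distrib)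

lemma square_integrable_add:
  assumes "square_integrable f" "square_integrable g"
  shows "square_integrable (\<lambda>t. f t + g t)"
proof -
  have [measurable]: "f \<in> borel_measurable halfline" "g \<in> borel_measurable halfline"
    using assms by (auto simp: square_integrable_def)
  have int: "integrable halfline (\<lambda>t. 2 * (cmod (f t))\<^sup>2 + 2 * (cmod (g t))\<^sup>2)"
    using assms by (auto simp: square_integrable_def)
  have "(cmod (f t + g t))\<^sup>2 \<le> 2 * (cmod (f t))\<^sup>2 + 2 * (cmod (g t))\<^sup>2" for t
  proof -
    have "(cmod (f t + g t))\<^sup>2 \<le> (cmod (f t) + cmod (g t))\<^sup>2"
      by (intro power_mono norm_triangle_ineq norm_ge_zero)
    also have "\<dots> \<le> 2 * (cmod (f t))\<^sup>2 + 2 * (cmod (g t))\<^sup>2"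
      using zero_le_power2[of "cmod (f t) - cmod (g t)"]
      by (simp add: power2_eq_square algebra_simps)
    finally show ?thesis .
  qed
  then have "integrable halfline (\<lambda>t. (cmod (f t + g t))\<^sup>2)"
    by (intro Bochner_Integration.integrable_bound[OF int]) (auto intro!: AE_I2)
  then show ?thesis
    by (simp add: square_integrable_def)
qed

lemma square_integrable_cinner:
  assumes "square_integrable f" "square_integrable g"
  shows "integrable halfline (\<lambda>t. f t * cnj (g t))"
proof -
  have [measurable]: "f \<in> borel_measurable halfline" "g \<in> borel_measurable halfline"
    using assms by (auto simp: square_integrable_def)
  have int: "integrable halfline (\<lambda>t. (cmod (f t))\<^sup>2 + (cmod (g t))\<^sup>2)"
    using assms by (auto simp: square_integrable_def)
  have "cmod (f t * cnj (g t)) \<le> (cmod (f t))\<^sup>2 + (cmod (g t))\<^sup>2" for t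
  proof -
    have "2 * (cmod (f t) * cmod (g t)) \<le> (cmod (f t))\<^sup>2 + (cmod (g t))\<^sup>2"
      using zero_le_power2[of "cmod (f t) - cmod (g t)"]
      by (simp add: power2_eq_square algebra_simps)
    moreover have "0 \<le> cmod (f t) * cmod (g t)" by simp
    ultimately show ?thesis unfolding norm_mult complex_mod_cnj by linarith
  qed
  moreover have "(\<lambda>t. cnj (g t)) \<in> borel_measurable halfline"
    by (rule measurable_compose[OF _ borel_measurable_continuous_onI[of cnj]])
      (auto intro!: continuous_intros)
  then have "(\<lambda>t. f t * cnj (g t)) \<in> borel_measurable halfline"
    by simp
  ultimately show ?thesis
    by (intro Bochner_Integration.integrable_bound[OF int]) (auto intro!: AE_I2)
qed

quotient_type L2 = "real \<Rightarrow> complex" / partial: ae_eq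
proof (rule part_equivpI)
  show "\<exists>f. ae_eq f f"
    using square_integrable_0 by (auto simp: ae_eq_def)
  show "symp ae_eq"
    by (auto intro!: sympI simp: ae_eq_def)
  show "transp ae_eq"
    by (auto intro!: transpI simp: ae_eq_def)
qed

lift_definition cinner :: "L2 \<Rightarrow> L2 \<Rightarrow> complex" is
  "\<lambda>f g. \<integral>t. f t * cnj (g t) \<partial>halfline"
proof -
  fix f f' g g' assume "ae_eq f f'" "ae_eq g g'"
  moreover from this have "(\<lambda>t. f t * cnj (g t)) \<in> borel_measurable halfline"
    "(\<lambda>t. f' t * cnj (g' t)) \<in> borel_measurable halfline"
    by (auto simp: ae_eq_def intro!: borel_measurable_integrable square_integrable_cinner)
  ultimately show "(\<integral>t. f t * cnj (g t) \<partial>halfline) = (\<integral>t. f' t * cnj (g' t) \<partial>halfline)"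
    by (intro integral_cong_AE) (auto simp: ae_eq_def)
qed

lift_definition scaleC :: "complex \<Rightarrow> L2 \<Rightarrow> L2" (infixr "*\<^sub>C" 75) is
  "\<lambda>c f t. c * f t"
  by (auto simp: ae_eq_def square_integrable_scale)

instantiation L2 :: real_inner
begin

lift_definition zero_L2 :: L2 is "\<lambda>t. 0"
  by (simp add: ae_eq_def square_integrable_0)

lift_definition plus_L2 :: "L2 \<Rightarrow> L2 \<Rightarrow> L2" is "\<lambda>f g t. f t + g t"
  by (auto simp: ae_eq_def square_integrable_add)

definition "uminus f = (-1) *\<^sub>C f" for f :: L2
definition "f - g = f + (-1) *\<^sub>C g" for f g :: L2
definition "r *\<^sub>R f = complex_of_real r *\<^sub>C f" for f :: L2
definition "inner f g = Re (cinner f g)" for f g :: L2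
definition "norm f = sqrt (inner f f)" for f :: L2
definition "dist f g = norm (f - g)" for f g :: L2
definition "sgn f = complex_of_real (inverse (norm f)) *\<^sub>C f" for f :: L2
definition "uniformity = (INF e\<in>{0<..}. principal {(f :: L2, g). dist f g < e})"
definition "open U \<longleftrightarrow> (\<forall>f\<in>U. \<forall>\<^sub>F (f', g) in uniformity. f' = f \<longrightarrow> g \<in> U)" for U :: "L2 set"

lemma cinner_add_left: "cinner (f + g) h = cinner f h + cinner g h"
  by transfer (simp add: ae_eq_def distrib_right square_integrable_cinner)

lemma cinner_scaleC_left: "cinner (c *\<^sub>C f) g = c * cinner f g"
  by transfer (simp add: mult.assoc)

lemma cinner_commute: "cinner f g = cnj (cinner g f)"
  by transfer (simp flip: Bochner_Integration.integral_cnj add: mult.commute)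

lemma cinner_self: "cinner f f = complex_of_real (Re (cinner f f))"
  using cinner_commute[of f f] by (simp add: complex_eq_iff)

lemma Re_cinner_self_ge_0: "0 \<le> Re (cinner f f)"
  by transfer (simp add: complex_norm_square[symmetric] del: of_real_power)

lemma Re_cinner_self_eq_0: "Re (cinner f f) = 0 \<longleftrightarrow> f = 0"
  by transfer
    (simp add: ae_eq_def complex_norm_square[symmetric] square_integrable_0
      square_integrable_def integral_nonneg_eq_0_iff_AE del: of_real_power)

instance
proof
  fix f g h :: L2 and a b :: real
  show "f + g + h = f + (g + h)"
    by transfer (auto simp: ae_eq_def add.assoc intro!: square_integrable_add)
  show "f + g = g + f"
    by transfer (auto simp: ae_eq_def add.commute intro!: square_integrable_add)
  show "0 + f = f"
    by transfer (auto simp: ae_eq_def)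
  show "- f + f = 0"
    unfolding uminus_L2_def
    by transfer (auto simp: ae_eq_def square_integrable_0
        intro!: square_integrable_add square_integrable_scale[of _ "-1", simplified])
  show "f - g = f + - g"
    by (simp add: uminus_L2_def minus_L2_def)
  show "a *\<^sub>R (f + g) = a *\<^sub>R f + a *\<^sub>R g"
    unfolding scaleR_L2_def
    by transfer (auto simp: ae_eq_def distrib_left intro!: square_integrable_add square_integrable_scale)
  show "(a + b) *\<^sub>R f = a *\<^sub>R f + b *\<^sub>R f"
    unfolding scaleR_L2_def
    by transfer (auto simp: ae_eq_def distrib_right intro!: square_integrable_add square_integrable_scale)
  show "a *\<^sub>R b *\<^sub>R f = (a * b) *\<^sub>R f"
    unfolding scaleR_L2_def
    by transfer (auto simp: ae_eq_def mult.assoc intro!: square_integrable_scale)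
  show "1 *\<^sub>R f = f"
    unfolding scaleR_L2_def by transfer (auto simp: ae_eq_def)
  show "dist f g = norm (f - g)" "sgn f = inverse (norm f) *\<^sub>R f"
    by (simp_all add: dist_L2_def sgn_L2_def scaleR_L2_def)
  show "uniformity = (INF e\<in>{0<..}. principal {(x :: L2, y). dist x y < e})"
    by (fact uniformity_L2_def)
  show "open U \<longleftrightarrow> (\<forall>x\<in>U. \<forall>\<^sub>F (x', y) in uniformity. x' = x \<longrightarrow> y \<in> U)" for U :: "L2 set"
    by (fact open_L2_def)
  show "inner f g = inner g f"
    unfolding inner_L2_def by (subst cinner_commute) simp
  show "inner (f + g) h = inner f h + inner g h"
    by (simp add: inner_L2_def cinner_add_left)
  show "inner (a *\<^sub>R f) g = a * inner f g"
    by (simp add: inner_L2_def scaleR_L2_def cinner_scaleC_left)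
  show "0 \<le> inner f f" "inner f f = 0 \<longleftrightarrow> f = 0"
    by (simp_all add: inner_L2_def Re_cinner_self_ge_0 Re_cinner_self_eq_0)
  show "norm f = sqrt (inner f f)"
    by (fact norm_L2_def)
qed

end

global_interpretation L2: vector_space "scaleC :: complex \<Rightarrow> L2 \<Rightarrow> L2"
proof
  fix f g :: L2 and a b :: complex
  show "a *\<^sub>C (f + g) = a *\<^sub>C f + a *\<^sub>C g"
    by transfer (auto simp: ae_eq_def distrib_left intro!: square_integrable_add square_integrable_scale)
  show "(a + b) *\<^sub>C f = a *\<^sub>C f + b *\<^sub>C f"
    by transfer (auto simp: ae_eq_def distrib_right intro!: square_integrable_add square_integrable_scale)
  show "a *\<^sub>C b *\<^sub>C f = (a * b) *\<^sub>C f"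
    by transfer (auto simp: ae_eq_def mult.assoc intro!: square_integrable_scale)
  show "1 *\<^sub>C f = f"
    by transfer (auto simp: ae_eq_def)
qed


section \<open>Operators\<close>

text \<open>\<^term>\<open>bounded_linear\<close> only speaks about real scalars, so complex homogeneity is
  required separately.\<close>

definition bounded_operator :: "(L2 \<Rightarrow> L2) \<Rightarrow> bool" where
  "bounded_operator A \<longleftrightarrow> bounded_linear A \<and> (\<forall>c f. A (c *\<^sub>C f) = c *\<^sub>C A f)"

definition self_adjoint :: "(L2 \<Rightarrow> L2) \<Rightarrow> bool" where
  "self_adjoint A \<longleftrightarrow> bounded_operator A \<and> (\<forall>f g. cinner (A f) g = cinner f (A g))"

definition nonneg_operator :: "(L2 \<Rightarrow> L2) \<Rightarrow> bool" where
  "nonneg_operator A \<longleftrightarrow> (\<forall>f. cinner (A f) f \<in> \<real>\<^sub>\<ge>\<^sub>0)"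

text \<open>The complex dimension, with value \<open>\<infinity>\<close> on subspaces that are not finite-dimensional
  (where \<^term>\<open>L2.dim\<close> would be \<open>0\<close>).\<close>

definition edim :: "L2 set \<Rightarrow> enat" where
  "edim S = (if \<exists>B. finite B \<and> S \<subseteq> L2.span B then enat (L2.dim S) else \<infinity>)"

definition finite_rank :: "(L2 \<Rightarrow> L2) \<Rightarrow> bool" where
  "finite_rank A \<longleftrightarrow> edim (range A) < \<infinity>"

definition spectrum :: "(L2 \<Rightarrow> L2) \<Rightarrow> complex set" where
  "spectrum A = {z. \<not> (\<exists>R. bounded_operator R \<and>
     (\<forall>f. R (A f - z *\<^sub>C f) = f) \<and> (\<forall>f. A (R f) - z *\<^sub>C R f = f))}"

definition negative_spectrum :: "(L2 \<Rightarrow> L2) \<Rightarrow> real set" where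
  "negative_spectrum A = {x. x < 0 \<and> complex_of_real x \<in> spectrum A}"

definition multiplicity :: "(L2 \<Rightarrow> L2) \<Rightarrow> real \<Rightarrow> enat" where
  "multiplicity A x = edim {f. A f = complex_of_real x *\<^sub>C f}"

text \<open>The total multiplicity of the strictly negative spectrum of a self-adjoint operator.
  If the negative spectrum is finite, then its points are isolated in the spectrum and hence
  eigenvalues, and their multiplicities (possibly \<open>\<infinity>\<close>) are added up. An infinite negative
  spectrum has infinite total multiplicity; this case cannot be expressed by a sum over
  eigenvalues, because of continuous spectrum. In both cases the value is the dimension of the
  spectral subspace of \<open>A\<close> for the interval \<open>(-\<infinity>, 0)\<close>.\<close>

definition N_minus :: "(L2 \<Rightarrow> L2) \<Rightarrow> enat" where
  "N_minus A = (if finite (negative_spectrum A)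
     then \<Sum>x\<in>negative_spectrum A. multiplicity A x else \<infinity>)"


section \<open>Hankel operators\<close>

definition hankel_integral :: "(real \<Rightarrow> complex) \<Rightarrow> L2 \<Rightarrow> real \<Rightarrow> complex" where
  "hankel_integral h f t = (\<integral>s. h (t + s) * rep_L2 f s \<partial>halfline)"

definition hankel_operator :: "(real \<Rightarrow> complex) \<Rightarrow> L2 \<Rightarrow> L2" where
  "hankel_operator h f = abs_L2 (hankel_integral h f)"

text \<open>\<^const>\<open>hankel_operator\<close> is meaningful for the following kernels. Convergence is demanded
  explicitly because the integral of a non-integrable function is \<open>0\<close> by convention.\<close>

definition hankel_kernel :: "(real \<Rightarrow> complex) \<Rightarrow> bool" where
  "hankel_kernel h \<longleftrightarrow> h \<in> borel_measurable halfline \<and>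
     (\<forall>f. (AE t in halfline. integrable halfline (\<lambda>s. h (t + s) * rep_L2 f s)) \<and>
          square_integrable (hankel_integral h f))"

definition is_hankel_operator :: "(L2 \<Rightarrow> L2) \<Rightarrow> bool" where
  "is_hankel_operator A \<longleftrightarrow> (\<exists>h. hankel_kernel h \<and> A = hankel_operator h)"

text \<open>The kernel of the Carleman operator satisfies \<^const>\<open>hankel_kernel\<close> by Hilbert's
  inequality.\<close>

definition carleman_operator :: "L2 \<Rightarrow> L2" where
  "carleman_operator = hankel_operator (\<lambda>t. complex_of_real (1 / t))"

end

(*
  The Carleman operator is the square of the Laplace transform L, so (H0 f, f) = |L f|^2 and H >= V;
  hence N_-(H) <= N_-(V).  For the converse one has to see that V stays negative on vectors with
  small |L f|: prescribing the components of f in the finite-dimensional space range V must leave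
  L f arbitrarily small.  By duality this means that no u <> 0 in range V satisfies
  |(f, u)| <= C |L f| for all f.  As V is Hankel, range V is invariant under the left shift by 1,
  so p(left shift) u = 0 for some polynomial p <> 0.  The adjoint right shift becomes
  multiplication by exp(-x) under L, hence polynomials in it reduce |L f| to 0 without changing (f, u).

  The counting functions are compared through finite orthonormal systems of eigenvectors with
  negative eigenvalues on whose orthogonal complement the operator is nonnegative.
*)
theory Submission
  imports Defs
begin

section \<open>Complex inner products, operators and orthonormal systems\<close>

text \<open>A negative eigenvector \<open>e\<close> of \<open>V\<close> may have a large
  \<open>laplace e\<close>, so the form of \<open>H\<close> need not be negative at \<open>e\<close>
  itself. The remedy is to replace \<open>e\<close> by some \<open>f\<close> with
  \<open>V f = V e\<close>: self-adjointness gives \<open>(V f, f) = (V e, e)\<close>, so only the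
  Carleman part of the form changes. It has to become small, not zero, because the finitely many
  negative eigenvalues of \<open>V\<close> stay away from 0. On the counting side, the point is that
  below 0 only eigenvalues occur, although the unperturbed operator is not compact. For
  \<open>m < 0\<close> a nonnegative operator has a bounded resolvent at \<open>m\<close>, and a
  finite-rank perturbation maps bounded sequences to sequences with convergent subsequences.
  Together these make a minimising sequence of the form converge in norm whenever the infimum is
  negative. So every negative value of the form on the complement of the eigenvectors already found
  produces a further one, and the rank bounds how often this can happen.\<close>

lemma cinner_add_right: "cinner f (g + h) = cinner f g + cinner f h"
  using arg_cong[OF cinner_add_left[of g h f], of cnj]
  unfolding complex_cnj_add cinner_commute[symmetric] .

lemma cinner_scaleC_right: "cinner f (c *\<^sub>C g) = cnj c * cinner f g"
  using arg_cong[OF cinner_scaleC_left[of c g f], of cnj]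
  unfolding complex_cnj_mult cinner_commute[symmetric] .

lemma cinner_diff_left: "cinner (f - g) h = cinner f h - cinner g h"
  by (simp only: minus_L2_def cinner_add_left cinner_scaleC_left) simp

lemma cinner_diff_right: "cinner f (g - h) = cinner f g - cinner f h"
  by (simp only: minus_L2_def cinner_add_right cinner_scaleC_right) simp

lemma cinner_zero_left [simp]: "cinner 0 f = 0"
  using cinner_diff_left[of 0 0 f] by simp

lemma cinner_zero_right [simp]: "cinner f 0 = 0"
  using cinner_diff_right[of f 0 0] by simp

lemma cinner_sum_left: "cinner (\<Sum>i\<in>I. f i) g = (\<Sum>i\<in>I. cinner (f i) g)"
  by (induction I rule: infinite_finite_induct) (auto simp: cinner_add_left)

lemma cinner_sum_right: "cinner g (\<Sum>i\<in>I. f i) = (\<Sum>i\<in>I. cinner g (f i))"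
  by (induction I rule: infinite_finite_induct) (auto simp: cinner_add_right)

lemmas cinner_simps = cinner_add_left cinner_add_right cinner_diff_left cinner_diff_right
  cinner_scaleC_left cinner_scaleC_right

lemma cinner_self_norm: "cinner f f = complex_of_real ((norm f)\<^sup>2)"
  by (subst cinner_self) (simp add: power2_norm_eq_inner inner_L2_def)

lemma cinner_self_eq_0: "cinner f f = 0 \<longleftrightarrow> f = 0"
  by (simp add: cinner_self_norm)

lemma scaleR_eq_scaleC: "r *\<^sub>R (f :: L2) = complex_of_real r *\<^sub>C f"
  by (fact scaleR_L2_def)

lemma norm_scaleC: "norm (c *\<^sub>C f) = cmod c * norm f"
proof -
  have "complex_of_real ((norm (c *\<^sub>C f))\<^sup>2) = (c * cnj c) * complex_of_real ((norm f)\<^sup>2)"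
    by (simp only: cinner_self_norm[symmetric] cinner_simps mult_ac)
  also have "\<dots> = complex_of_real ((cmod c * norm f)\<^sup>2)"
    by (simp only: complex_norm_square[symmetric] power_mult_distrib of_real_mult)
  finally have "(norm (c *\<^sub>C f))\<^sup>2 = (cmod c * norm f)\<^sup>2"
    by (simp only: of_real_eq_iff)
  then show ?thesis by simp
qed

text \<open>Reduces to the real Cauchy-Schwarz inequality of \<open>inner\<close>: multiplying
  \<open>f\<close> by the phase \<open>c\<close> makes the product real and nonnegative without
  changing the norm of \<open>f\<close>.\<close>

lemma cmod_cinner_le: "cmod (cinner f g) \<le> norm f * norm g"
proof (cases "cinner f g = 0")
  case False
  define z where "z = cinner f g"
  define c where "c = cnj z / complex_of_real (cmod z)"
  have z: "z \<noteq> 0" using False by (simp add: z_def)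
  have c: "cmod c = 1" using z by (simp add: c_def norm_divide)
  have "c * z = complex_of_real (cmod z)"
  proof -
    have "c * z = (z * cnj z) / complex_of_real (cmod z)" by (simp add: c_def)
    also have "\<dots> = complex_of_real ((cmod z)\<^sup>2) / complex_of_real (cmod z)"
      by (simp only: complex_norm_square)
    also have "\<dots> = complex_of_real (cmod z)" using z by (simp add: power2_eq_square)
    finally show ?thesis .
  qed
  then have "cmod z = inner (c *\<^sub>C f) g"
    by (simp add: inner_L2_def cinner_scaleC_left z_def)
  also have "\<dots> \<le> norm f * norm g"
    using norm_cauchy_schwarz[of "c *\<^sub>C f" g] c by (simp add: norm_scaleC)
  finally show ?thesis by (simp add: z_def)
qed simp

lemma tendsto_cinner_left: "f \<longlonglongrightarrow> g \<Longrightarrow> (\<lambda>n. cinner (f n) h) \<longlonglongrightarrow> cinner g h"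
proof -
  assume "f \<longlonglongrightarrow> g"
  then have "(\<lambda>n. norm (f n - g) * norm h) \<longlonglongrightarrow> 0"
    by (intro tendsto_mult_left_zero tendsto_norm_zero LIM_zero)
  then have "(\<lambda>n. cinner (f n) h - cinner g h) \<longlonglongrightarrow> 0"
    by (rule Lim_null_comparison[rotated])
      (simp add: cinner_diff_left[symmetric] cmod_cinner_le)
  then show ?thesis by (rule LIM_zero_cancel)
qed

section \<open>Complex-linear, bounded and self-adjoint operators\<close>

definition clinear_op :: "(L2 \<Rightarrow> L2) \<Rightarrow> bool" where
  "clinear_op A \<longleftrightarrow> (\<forall>f g. A (f + g) = A f + A g) \<and> (\<forall>c f. A (c *\<^sub>C f) = c *\<^sub>C A f)"

lemma clinear_op_add: "clinear_op A \<Longrightarrow> A (f + g) = A f + A g"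
  and clinear_op_scaleC: "clinear_op A \<Longrightarrow> A (c *\<^sub>C f) = c *\<^sub>C A f"
  by (auto simp: clinear_op_def)

lemma clinear_op_diff: "clinear_op A \<Longrightarrow> A (f - g) = A f - A g"
  by (simp only: minus_L2_def clinear_op_add clinear_op_scaleC)

lemma clinear_op_0: "clinear_op A \<Longrightarrow> A 0 = 0"
  using clinear_op_diff[of A 0 0] by simp

lemma clinear_op_sum: "clinear_op A \<Longrightarrow> A (\<Sum>i\<in>I. f i) = (\<Sum>i\<in>I. A (f i))"
  by (induction I rule: infinite_finite_induct) (auto simp: clinear_op_add clinear_op_0)

lemma clinear_op_id: "clinear_op (\<lambda>f. f)"
  by (simp add: clinear_op_def)

lemma clinear_op_comp: "clinear_op A \<Longrightarrow> clinear_op B \<Longrightarrow> clinear_op (\<lambda>f. A (B f))"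
  by (simp add: clinear_op_def)

lemma clinear_op_plus: "clinear_op A \<Longrightarrow> clinear_op B \<Longrightarrow> clinear_op (\<lambda>f. A f + B f)"
  by (simp add: clinear_op_def L2.scale_right_distrib)

lemma clinear_op_scale: "clinear_op A \<Longrightarrow> clinear_op (\<lambda>f. c *\<^sub>C A f)"
  by (simp add: clinear_op_def L2.scale_right_distrib mult.commute)

lemma clinear_op_rank_one: "clinear_op (\<lambda>f. (c * cinner f g) *\<^sub>C h)"
  by (simp add: clinear_op_def cinner_simps L2.scale_left_distrib algebra_simps)

text \<open>Separates the algebraic part from the norm bound, so that each closure property below
  needs only complex linearity and one explicit constant.\<close>

lemma bounded_operator_iff:
  "bounded_operator A \<longleftrightarrow> clinear_op A \<and> (\<exists>C. \<forall>f. norm (A f) \<le> C * norm f)"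
proof
  assume "bounded_operator A"
  then show "clinear_op A \<and> (\<exists>C. \<forall>f. norm (A f) \<le> C * norm f)"
    unfolding bounded_operator_def clinear_op_def
    using bounded_linear.bounded[of A] bounded_linear.linear[of A, THEN linear_add]
    by (auto simp: mult.commute)
next
  assume *: "clinear_op A \<and> (\<exists>C. \<forall>f. norm (A f) \<le> C * norm f)"
  then obtain C where "\<And>f. norm (A f) \<le> C * norm f" by auto
  then have "bounded_linear A"
    using * by (intro bounded_linear_intro[of _ C])
      (auto simp: clinear_op_def scaleR_eq_scaleC mult.commute)
  then show "bounded_operator A" using * by (simp add: bounded_operator_def clinear_op_def)
qed

lemma bounded_operatorE:
  assumes "bounded_operator A"
  obtains C where "C > 0" "\<And>f. norm (A f) \<le> C * norm f"
proof -
  obtain C where C: "\<And>f. norm (A f) \<le> C * norm f"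
    using assms by (auto simp: bounded_operator_iff)
  have "norm (A f) \<le> max C 1 * norm f" for f
    by (rule order_trans[OF C]) (simp add: mult_right_mono)
  then show ?thesis using that[of "max C 1"] by auto
qed

lemma bounded_operator_clinear: "bounded_operator A \<Longrightarrow> clinear_op A"
  by (simp add: bounded_operator_iff)

lemma bounded_operator_scale:
  assumes "bounded_operator A" shows "bounded_operator (\<lambda>f. c *\<^sub>C A f)"
proof -
  obtain C where C: "\<And>f. norm (A f) \<le> C * norm f" using assms bounded_operatorE by blast
  have "norm (c *\<^sub>C A f) \<le> (cmod c * C) * norm f" for f
    using mult_left_mono[OF C, of "cmod c"] by (simp add: norm_scaleC mult.assoc)
  then show ?thesis using assms unfolding bounded_operator_iff
    by (blast intro: clinear_op_scale)
qed

lemma bounded_operator_id: "bounded_operator (\<lambda>f. f)"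
  by (auto simp: bounded_operator_iff clinear_op_id intro!: exI[of _ 1])

lemma bounded_operator_plus:
  assumes "bounded_operator A" "bounded_operator B"
  shows "bounded_operator (\<lambda>f. A f + B f)"
proof -
  obtain C where C: "\<And>f. norm (A f) \<le> C * norm f" using assms bounded_operatorE by blast
  obtain D where D: "\<And>f. norm (B f) \<le> D * norm f" using assms bounded_operatorE by blast
  have "norm (A f + B f) \<le> (C + D) * norm f" for f
    using norm_triangle_ineq[of "A f" "B f"] C[of f] D[of f] by (simp add: algebra_simps)
  then show ?thesis using assms unfolding bounded_operator_iff
    by (blast intro: clinear_op_plus)
qed

lemma bounded_operator_minus:
  assumes "bounded_operator A" "bounded_operator B"
  shows "bounded_operator (\<lambda>f. A f - B f)"
  using bounded_operator_plus[OF assms(1) bounded_operator_scale[OF assms(2), of "-1"]]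
  by (simp only: minus_L2_def)

lemma bounded_operator_sum:
  assumes "finite I" "\<And>i. i \<in> I \<Longrightarrow> bounded_operator (A i)"
  shows "bounded_operator (\<lambda>f. \<Sum>i\<in>I. A i f)"
  using assms
proof (induction I rule: finite_induct)
  case empty
  show ?case by (auto simp: bounded_operator_iff clinear_op_def intro!: exI[of _ 0])
qed (auto intro: bounded_operator_plus)

lemma bounded_operator_rank_one: "bounded_operator (\<lambda>f. (c * cinner f g) *\<^sub>C h)"
proof -
  have "norm ((c * cinner f g) *\<^sub>C h) \<le> (cmod c * norm g * norm h) * norm f" for f
    using mult_right_mono[OF mult_left_mono[OF cmod_cinner_le, of "cmod c"], of "norm h" f g]
    by (simp add: norm_scaleC norm_mult algebra_simps)
  then show ?thesis unfolding bounded_operator_iff using clinear_op_rank_one by blast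
qed

lemma tendsto_bounded_operator:
  assumes "bounded_operator A" "f \<longlonglongrightarrow> g"
  shows "(\<lambda>n. A (f n)) \<longlonglongrightarrow> A g"
  using assms bounded_linear.tendsto unfolding bounded_operator_def by blast

lemma self_adjoint_real: "self_adjoint A \<Longrightarrow> cinner (A f) f = complex_of_real (inner (A f) f)"
  by (metis Reals_cnj_iff cinner_commute inner_L2_def of_real_Re self_adjoint_def)

lemma self_adjoint_inner: "self_adjoint A \<Longrightarrow> inner (A f) g = inner f (A g)"
  by (simp add: inner_L2_def self_adjoint_def)

lemma nonneg_operator_iff:
  "self_adjoint A \<Longrightarrow> nonneg_operator A \<longleftrightarrow> (\<forall>f. 0 \<le> inner (A f) f)"
  by (simp add: nonneg_operator_def self_adjoint_real)

lemma self_adjoint_scaleR: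
  "self_adjoint A \<Longrightarrow> self_adjoint (\<lambda>f. complex_of_real r *\<^sub>C A f)"
  by (simp add: self_adjoint_def bounded_operator_scale cinner_simps)

lemma self_adjoint_id: "self_adjoint (\<lambda>f. f)"
  by (simp add: self_adjoint_def bounded_operator_id)

lemma self_adjoint_plus:
  "self_adjoint A \<Longrightarrow> self_adjoint B \<Longrightarrow> self_adjoint (\<lambda>f. A f + B f)"
  by (simp add: self_adjoint_def bounded_operator_plus cinner_simps)

lemma self_adjoint_minus:
  "self_adjoint A \<Longrightarrow> self_adjoint B \<Longrightarrow> self_adjoint (\<lambda>f. A f - B f)"
  by (simp add: self_adjoint_def bounded_operator_minus cinner_simps)

section \<open>Finite orthonormal systems, projections and linear dependence\<close>

definition orthonormal :: "L2 set \<Rightarrow> bool" where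
  "orthonormal S \<longleftrightarrow> finite S \<and> (\<forall>u\<in>S. \<forall>v\<in>S. cinner u v = (if u = v then 1 else 0))"

definition proj :: "L2 set \<Rightarrow> L2 \<Rightarrow> L2" where
  "proj S f = (\<Sum>e\<in>S. cinner f e *\<^sub>C e)"

lemma cinner_orthonormal_sum:
  assumes "orthonormal S" "e \<in> S"
  shows "cinner (\<Sum>u\<in>S. c u *\<^sub>C u) e = c e"
proof -
  have "cinner (\<Sum>u\<in>S. c u *\<^sub>C u) e = (\<Sum>u\<in>S. if u = e then c u else 0)"
    unfolding cinner_sum_left cinner_scaleC_left
    using assms by (intro sum.cong) (auto simp: orthonormal_def)
  also have "\<dots> = c e" using assms by (auto simp: orthonormal_def)
  finally show ?thesis .
qed

lemma orthonormal_mono: "orthonormal S \<Longrightarrow> T \<subseteq> S \<Longrightarrow> orthonormal T"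
  unfolding orthonormal_def by (blast intro: finite_subset)

lemma cinner_proj: "orthonormal S \<Longrightarrow> e \<in> S \<Longrightarrow> cinner (proj S f) e = cinner f e"
  by (simp add: proj_def cinner_orthonormal_sum)

lemma proj_in_span: "proj S f \<in> L2.span S"
  unfolding proj_def by (intro L2.span_sum L2.span_scale L2.span_base)

lemma span_orthonormal: "orthonormal S \<Longrightarrow> f \<in> L2.span S \<Longrightarrow> \<exists>c. f = (\<Sum>u\<in>S. c u *\<^sub>C u)"
  by (auto simp: orthonormal_def L2.span_finite)

lemma proj_span: "orthonormal S \<Longrightarrow> f \<in> L2.span S \<Longrightarrow> proj S f = f"
  using span_orthonormal[of S f] by (auto simp: proj_def cinner_orthonormal_sum)

lemma orthonormal_independent: "orthonormal S \<Longrightarrow> L2.independent S"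
proof
  assume S: "orthonormal S" and "L2.dependent S"
  then obtain u v where uv: "v \<in> S" "u v \<noteq> 0" "(\<Sum>v\<in>S. u v *\<^sub>C v) = 0"
    by (auto simp: L2.dependent_finite orthonormal_def)
  then show False using cinner_orthonormal_sum[OF S, of v u] by auto
qed

lemma edim_span_orthonormal:
  assumes "orthonormal S" shows "edim (L2.span S) = enat (card S)"
proof -
  have "finite S" using assms by (simp add: orthonormal_def)
  then show ?thesis
    using L2.dim_span_eq_card_independent[OF orthonormal_independent[OF assms]]
    by (auto simp: edim_def)
qed

lemma orthonormal_insert:
  assumes S: "orthonormal S" and f: "f \<noteq> 0" "\<And>e. e \<in> S \<Longrightarrow> cinner f e = 0"
  shows "orthonormal (insert (complex_of_real (1 / norm f) *\<^sub>C f) S)" (is "orthonormal (insert ?g S)")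
    and "complex_of_real (1 / norm f) *\<^sub>C f \<notin> S"
proof -
  have g: "cinner ?g ?g = 1"
    using f(1) by (simp add: cinner_self_norm norm_scaleC norm_divide)
  have ge: "cinner ?g e = 0" "cinner e ?g = 0" if "e \<in> S" for e
    using f(2)[OF that] by (simp_all add: cinner_simps cinner_commute[of e f])
  show "?g \<notin> S" using g ge by fastforce
  then show "orthonormal (insert ?g S)" using S g ge by (auto simp: orthonormal_def)
qed

text \<open>A vector of \<open>B\<close> that already lies in the span of its predecessors has
  residual \<open>r = 0\<close> and is dropped, so \<open>S\<close> may be smaller than
  \<open>B\<close>.\<close>

lemma gram_schmidt:
  assumes "finite B" obtains S where "orthonormal S" "L2.span S = L2.span B"
proof -
  have "\<exists>S. orthonormal S \<and> L2.span S = L2.span B"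
    using assms
  proof (induction B rule: finite_induct)
    case empty
    show ?case by (rule exI[of _ "{}"]) (simp add: orthonormal_def)
  next
    case (insert b B)
    then obtain S where S: "orthonormal S" "L2.span S = L2.span B" by auto
    define r where "r = b - proj S b"
    have r: "cinner r e = 0" if "e \<in> S" for e
      using cinner_proj[OF S(1) that] by (simp add: r_def cinner_simps)
    have pS: "proj S b \<in> L2.span B" using proj_in_span[of S b] S by simp
    show ?case
    proof (cases "r = 0")
      case True
      then have "b \<in> L2.span B" using pS by (simp add: r_def)
      then show ?thesis using S by (intro exI[of _ S]) (simp add: L2.span_redundant)
    next
      case False
      define g where "g = complex_of_real (1 / norm r) *\<^sub>C r"
      have o: "orthonormal (insert g S)"
        using orthonormal_insert[OF S(1) False r] by (simp add: g_def)
      have b: "b = complex_of_real (norm r) *\<^sub>C g + proj S b"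
        using False by (simp add: g_def) (simp add: r_def)
      have "L2.span (insert g S) = L2.span (insert b B)"
      proof (rule L2.span_eq[THEN iffD2], intro conjI)
        have "b - proj S b \<in> L2.span (insert b B)"
          using pS by (intro L2.span_diff) (auto intro: L2.span_base L2.span_mono[THEN subsetD, of B])
        then have "g \<in> L2.span (insert b B)"
          by (simp add: g_def r_def L2.span_scale)
        moreover have "S \<subseteq> L2.span (insert b B)"
          using L2.span_superset[of S] S(2) L2.span_mono[of B "insert b B"] by auto
        ultimately show "insert g S \<subseteq> L2.span (insert b B)" by auto
        have "b \<in> L2.span (insert g S)"
          by (subst b, intro L2.span_add L2.span_scale)
            (auto intro: L2.span_base L2.span_mono[THEN subsetD, of S] proj_in_span)
        moreover have "B \<subseteq> L2.span (insert g S)"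
          using L2.span_superset[of B] S(2) L2.span_mono[of S "insert g S"] by auto
        ultimately show "insert b B \<subseteq> L2.span (insert g S)" by auto
      qed
      then show ?thesis using o by blast
    qed
  qed
  then show ?thesis using that by blast
qed

text \<open>Stated for indexed families because the vectors to which it is applied (projections,
  shifts of one vector) may coincide. A repeated vector gives a relation with coefficients 1 and -1;
  otherwise the family is a set that is too large to be independent.\<close>

lemma dependent_family:
  fixes v :: "'i \<Rightarrow> L2"
  assumes "finite I" "finite B" "v ` I \<subseteq> L2.span B" "card B < card I"
  obtains c where "\<exists>i\<in>I. c i \<noteq> 0" "(\<Sum>i\<in>I. c i *\<^sub>C v i) = 0"
proof (cases "inj_on v I")
  case True
  have "L2.dependent (v ` I)"
    using L2.independent_span_bound[OF assms(2) _ assms(3)] assms(4) card_image[OF True] by force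
  then obtain u where u: "\<exists>w\<in>v ` I. u w \<noteq> 0" "(\<Sum>w\<in>v ` I. u w *\<^sub>C w) = 0"
    using assms(1) by (auto simp: L2.dependent_finite)
  show ?thesis
    by (rule that[of "u \<circ> v"]) (use u True in \<open>auto simp: sum.reindex\<close>)
next
  case False
  then obtain i j where ij: "i \<in> I" "j \<in> I" "i \<noteq> j" "v i = v j" by (auto simp: inj_on_def)
  define c where "c k = (if k = i then 1 else if k = j then - 1 else 0 :: complex)" for k
  have "(\<Sum>k\<in>I. c k *\<^sub>C v k) = (\<Sum>k\<in>{i, j}. c k *\<^sub>C v k)"
    using ij assms(1) by (intro sum.mono_neutral_right) (auto simp: c_def)
  also have "\<dots> = 0" using ij by (simp add: c_def)
  finally show ?thesis using ij by (intro that[of c]) (auto simp: c_def)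
qed

section \<open>Representatives and completeness\<close>

lemma ae_eq_refl: "ae_eq F F \<longleftrightarrow> square_integrable F"
  by (auto simp: ae_eq_def)

lemma square_integrable_rep: "square_integrable (rep_L2 f)"
  using Quotient_rep_reflp[OF Quotient_L2] by (simp add: ae_eq_refl)

lemma rep_abs_AE: "square_integrable F \<Longrightarrow> AE t in halfline. rep_L2 (abs_L2 F) t = F t"
  using Quotient_rep_abs[OF Quotient_L2, of F] by (simp add: ae_eq_def)

lemma abs_rep_L2: "abs_L2 (rep_L2 f) = f"
  using Quotient_abs_rep[OF Quotient_L2] by simp

lemma abs_L2_eqI: "ae_eq F G \<Longrightarrow> abs_L2 F = abs_L2 G"
  using Quotient_rel_abs[OF Quotient_L2] by simp

lemma L2_eqI:
  assumes "AE t in halfline. rep_L2 f t = rep_L2 g t"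
  shows "f = g"
  using abs_L2_eqI[of "rep_L2 f" "rep_L2 g"] assms
  by (simp add: ae_eq_def square_integrable_rep abs_rep_L2)

lemma rep_L2_measurable [measurable]: "rep_L2 f \<in> borel_measurable halfline"
  using square_integrable_rep by (simp add: square_integrable_def)

lemma cinner_abs:
  "square_integrable F \<Longrightarrow> square_integrable G \<Longrightarrow>
    cinner (abs_L2 F) (abs_L2 G) = (\<integral>t. F t * cnj (G t) \<partial>halfline)"
  by (simp add: cinner.abs_eq ae_eq_refl)

lemma cinner_rep: "cinner f g = (\<integral>t. rep_L2 f t * cnj (rep_L2 g t) \<partial>halfline)"
  using cinner_abs[OF square_integrable_rep square_integrable_rep, of f g] by (simp add: abs_rep_L2)

lemma cinner_abs_right:
  "square_integrable G \<Longrightarrow> cinner f (abs_L2 G) = (\<integral>t. rep_L2 f t * cnj (G t) \<partial>halfline)"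
  using cinner_abs[OF square_integrable_rep, of G f] by (simp add: abs_rep_L2)

lemma rep_add_AE: "AE t in halfline. rep_L2 (f + g) t = rep_L2 f t + rep_L2 g t"
proof -
  have "f + g = abs_L2 (\<lambda>t. rep_L2 f t + rep_L2 g t)"
    using plus_L2.abs_eq[of "rep_L2 f" "rep_L2 g"]
    by (simp add: ae_eq_refl square_integrable_rep abs_rep_L2)
  then show ?thesis
    using rep_abs_AE[OF square_integrable_add[OF square_integrable_rep square_integrable_rep]] by simp
qed

lemma rep_scaleC_AE: "AE t in halfline. rep_L2 (c *\<^sub>C f) t = c * rep_L2 f t"
proof -
  have "c *\<^sub>C f = abs_L2 (\<lambda>t. c * rep_L2 f t)"
    using scaleC.abs_eq[of "rep_L2 f" c]
    by (simp add: ae_eq_refl square_integrable_rep abs_rep_L2)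
  then show ?thesis
    using rep_abs_AE[OF square_integrable_scale[OF square_integrable_rep]] by simp
qed

lemma rep_diff_AE: "AE t in halfline. rep_L2 (f - g) t = rep_L2 f t - rep_L2 g t"
  using rep_add_AE[of f "(-1) *\<^sub>C g"] rep_scaleC_AE[of "-1" g]
  unfolding minus_L2_def by eventually_elim simp

lemma square_integrable_nn_integral:
  "square_integrable F \<longleftrightarrow> F \<in> borel_measurable halfline \<and>
     (\<integral>\<^sup>+t. ennreal ((cmod (F t))\<^sup>2) \<partial>halfline) < \<infinity>"
  by (auto simp: square_integrable_def integrable_iff_bounded)

lemma norm_nn_integral: "ennreal ((norm f)\<^sup>2) = (\<integral>\<^sup>+t. ennreal ((cmod (rep_L2 f t))\<^sup>2) \<partial>halfline)"
proof -
  have "complex_of_real ((norm f)\<^sup>2) = (\<integral>t. complex_of_real ((cmod (rep_L2 f t))\<^sup>2) \<partial>halfline)"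
    by (simp only: cinner_self_norm[symmetric] cinner_rep complex_norm_square)
  also have "\<dots> = complex_of_real (\<integral>t. (cmod (rep_L2 f t))\<^sup>2 \<partial>halfline)"
    by (rule integral_complex_of_real)
  finally have "(norm f)\<^sup>2 = (\<integral>t. (cmod (rep_L2 f t))\<^sup>2 \<partial>halfline)"
    by (simp only: of_real_eq_iff)
  then show ?thesis
    using square_integrable_rep[of f] by (simp add: nn_integral_eq_integral square_integrable_def)
qed

lemma norm_abs_nn_integral:
  assumes "square_integrable F"
  shows "ennreal ((norm (abs_L2 F))\<^sup>2) = (\<integral>\<^sup>+t. ennreal ((cmod (F t))\<^sup>2) \<partial>halfline)"
  unfolding norm_nn_integral
  by (rule nn_integral_cong_AE) (use rep_abs_AE[OF assms] in \<open>auto elim!: eventually_mono\<close>)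

lemma dist_nn_integral:
  "ennreal ((dist f g)\<^sup>2) = (\<integral>\<^sup>+t. ennreal ((cmod (rep_L2 f t - rep_L2 g t))\<^sup>2) \<partial>halfline)"
  unfolding dist_norm norm_nn_integral
  by (rule nn_integral_cong_AE) (use rep_diff_AE[of f g] in \<open>auto elim!: eventually_mono\<close>)

section \<open>Completeness of the space (Riesz-Fischer)\<close>

lemma Cauchy_subseq_geometric:
  fixes X :: "nat \<Rightarrow> 'a :: metric_space"
  assumes "Cauchy X" "0 < (q :: real)"
  obtains r where "strict_mono r" "\<And>n. dist (X (r (Suc n))) (X (r n)) < q ^ n"
proof -
  have "\<forall>n. \<exists>N. \<forall>i\<ge>N. \<forall>j\<ge>N. dist (X i) (X j) < q ^ n"
    using assms by (auto simp: Cauchy_def)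
  then obtain N where N: "\<And>n i j. i \<ge> N n \<Longrightarrow> j \<ge> N n \<Longrightarrow> dist (X i) (X j) < q ^ n" by metis
  \<comment> \<open>\<open>Suc k\<close> keeps \<open>r\<close> strictly increasing, and
    \<open>N (Suc n)\<close> moves it far enough out for the next distance bound.\<close>
  define r where "r = rec_nat (N 0) (\<lambda>n k. max (Suc k) (N (Suc n)))"
  have r: "r 0 = N 0" "\<And>n. r (Suc n) = max (Suc (r n)) (N (Suc n))" by (simp_all add: r_def)
  have "strict_mono r" by (auto simp: strict_mono_Suc_iff r(2))
  moreover have rN: "r n \<ge> N n" for n by (cases n) (auto simp: r)
  have "dist (X (r (Suc n))) (X (r n)) < q ^ n" for n
    using rN[of n] by (intro N) (auto simp: r(2))
  ultimately show ?thesis using that by blast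
qed

text \<open>Square summability of the increments alone would not give convergence. With the weight
  \<open>2 ^ n\<close> the terms are eventually below 1, so the increments are dominated by a
  geometric sequence of ratio \<open>sqrt (1 / 2)\<close>.\<close>

lemma convergent_if_summable_weighted:
  fixes g :: "nat \<Rightarrow> complex"
  assumes "summable (\<lambda>n. 2 ^ n * (cmod (g (Suc n) - g n))\<^sup>2)"
  shows "convergent g"
proof -
  have "(\<lambda>n. 2 ^ n * (cmod (g (Suc n) - g n))\<^sup>2) \<longlonglongrightarrow> 0"
    using assms by (rule summable_LIMSEQ_zero)
  then have ev: "\<forall>\<^sub>F n in sequentially. 2 ^ n * (cmod (g (Suc n) - g n))\<^sup>2 < 1"
    by (rule order_tendstoD) simp
  have "\<forall>\<^sub>F n in sequentially. norm (g (Suc n) - g n) \<le> sqrt (1 / 2) ^ n"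
    using ev
  proof eventually_elim
    case (elim n)
    have "(cmod (g (Suc n) - g n))\<^sup>2 \<le> (1 / 2) ^ n"
      using elim by (simp add: field_simps power_divide)
    also have "\<dots> = (sqrt (1 / 2) ^ n)\<^sup>2"
      by (simp add: power_mult[symmetric] mult.commute[of n] power_mult)
    finally show ?case by (rule power2_le_imp_le) simp
  qed
  moreover have "summable (\<lambda>n. sqrt (1 / 2) ^ n)" by (intro summable_geometric) auto
  ultimately have "summable (\<lambda>n. g (Suc n) - g n)"
    by (rule summable_comparison_test_ev)
  then have "convergent (\<lambda>n. g n - g 0)"
    unfolding summable_iff_convergent by (simp add: sum_lessThan_telescope)
  then have "convergent (\<lambda>n. (g n - g 0) + g 0)"
    by (intro convergent_add convergent_const)
  then show ?thesis by simp
qed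

text \<open>A fast subsequence converges almost everywhere because the integral of its weighted
  squared increments is finite; Fatou's lemma then shows that the pointwise limit is also the limit
  in norm. Completeness is used for the fixed point in \<open>coercive_inverse\<close> and for the
  minimising sequence in \<open>orthogonal_residual\<close>.\<close>

instance L2 :: complete_space
proof
  fix X :: "nat \<Rightarrow> L2" assume X: "Cauchy X"
  \<comment> \<open>Squaring the ratio 1/4 and multiplying by the weight 2 leaves 1/8, so the series
    of integrals converges.\<close>
  obtain r where r: "strict_mono r"
    and d: "\<And>n. dist (X (r (Suc n))) (X (r n)) < (1 / 4) ^ n"
    by (rule Cauchy_subseq_geometric[OF X, of "1 / 4"]) auto
  define g where "g n = rep_L2 (X (r n))" for n
  have g_meas [measurable]: "g n \<in> borel_measurable halfline" for n by (simp add: g_def)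
  have "(\<integral>\<^sup>+t. (\<Sum>n. ennreal (2 ^ n * (cmod (g (Suc n) t - g n t))\<^sup>2)) \<partial>halfline)
    = (\<Sum>n. \<integral>\<^sup>+t. ennreal (2 ^ n * (cmod (g (Suc n) t - g n t))\<^sup>2) \<partial>halfline)"
    by (intro nn_integral_suminf) measurable
  also have "\<dots> = (\<Sum>n. ennreal (2 ^ n * (dist (X (r (Suc n))) (X (r n)))\<^sup>2))"
    by (intro suminf_cong) (simp add: ennreal_mult dist_nn_integral g_def nn_integral_cmult)
  also have "\<dots> \<le> (\<Sum>n. ennreal ((1 / 8) ^ n))"
  proof (intro suminf_le ennreal_leI)
    fix n
    have "(dist (X (r (Suc n))) (X (r n)))\<^sup>2 \<le> ((1 / 4) ^ n)\<^sup>2"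
      using d[of n] by (intro power_mono) auto
    then have "2 ^ n * (dist (X (r (Suc n))) (X (r n)))\<^sup>2 \<le> 2 ^ n * ((1 / 4) ^ n)\<^sup>2"
      by (intro mult_left_mono) auto
    also have "\<dots> = (2 * (1 / 4 * (1 / 4))) ^ n"
      by (simp only: power_mult_distrib power2_eq_square)
    finally show "2 ^ n * (dist (X (r (Suc n))) (X (r n)))\<^sup>2 \<le> (1 / 8) ^ n" by simp
  qed auto
  also have "\<dots> = ennreal (\<Sum>n. (1 / 8) ^ n)"
    by (intro suminf_ennreal2) (auto intro!: summable_geometric)
  finally have "(\<integral>\<^sup>+t. (\<Sum>n. ennreal (2 ^ n * (cmod (g (Suc n) t - g n t))\<^sup>2)) \<partial>halfline) \<noteq> \<infinity>"
    by (auto simp: top_unique)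
  then have "AE t in halfline. (\<Sum>n. ennreal (2 ^ n * (cmod (g (Suc n) t - g n t))\<^sup>2)) \<noteq> \<infinity>"
    by (intro nn_integral_noteq_infinite) measurable
  then have "AE t in halfline. convergent (\<lambda>n. g n t)"
    by eventually_elim (auto intro!: convergent_if_summable_weighted summable_suminf_not_top)
  then have lim: "AE t in halfline. (\<lambda>n. g n t) \<longlonglongrightarrow> lim (\<lambda>n. g n t)"
    by eventually_elim (simp add: convergent_LIMSEQ_iff)
  define G where "G t = lim (\<lambda>n. g n t)" for t
  have [measurable]: "G \<in> borel_measurable halfline"
    unfolding G_def by measurable
  \<comment> \<open>Used twice: with \<open>e = 1\<close> to see that \<open>G\<close> is square
    integrable, and with \<open>e / 2\<close> for convergence in norm.\<close>
  have fatou: "(\<integral>\<^sup>+t. ennreal ((cmod (g n t - G t))\<^sup>2) \<partial>halfline) \<le> ennreal (e\<^sup>2)"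
    if e: "\<And>m. m \<ge> N \<Longrightarrow> dist (X (r n)) (X (r m)) < e" for n N e
  proof -
    have "(\<integral>\<^sup>+t. ennreal ((cmod (g n t - G t))\<^sup>2) \<partial>halfline)
      = (\<integral>\<^sup>+t. liminf (\<lambda>m. ennreal ((cmod (g n t - g m t))\<^sup>2)) \<partial>halfline)"
    proof (rule nn_integral_cong_AE)
      show "AE t in halfline. ennreal ((cmod (g n t - G t))\<^sup>2)
        = liminf (\<lambda>m. ennreal ((cmod (g n t - g m t))\<^sup>2))"
        using lim
        by eventually_elim
          (rule lim_imp_Liminf[symmetric], auto simp: G_def intro!: tendsto_intros)
    qed
    also have "\<dots> \<le> liminf (\<lambda>m. \<integral>\<^sup>+t. ennreal ((cmod (g n t - g m t))\<^sup>2) \<partial>halfline)"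
      by (rule nn_integral_liminf) measurable
    also have "\<dots> = liminf (\<lambda>m. ennreal ((dist (X (r n)) (X (r m)))\<^sup>2))"
      by (simp add: dist_nn_integral g_def)
    also have "\<dots> \<le> limsup (\<lambda>m. ennreal ((dist (X (r n)) (X (r m)))\<^sup>2))"
      by (intro Liminf_le_Limsup) simp
    also have "\<dots> \<le> ennreal (e\<^sup>2)"
      by (intro Limsup_bounded eventually_sequentiallyI[of N] ennreal_leI power_mono)
        (auto intro!: less_imp_le e)
    finally show ?thesis .
  qed
  have cauchy: "\<exists>N. \<forall>n\<ge>N. \<forall>m\<ge>N. dist (X (r n)) (X (r m)) < e" if "e > 0" for e
    using Cauchy_subseq_Cauchy[OF X r] that unfolding Cauchy_def by auto
  obtain N where "\<And>n m. n \<ge> N \<Longrightarrow> m \<ge> N \<Longrightarrow> dist (X (r n)) (X (r m)) < 1"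
    using cauchy[of 1] by auto
  then have "(\<integral>\<^sup>+t. ennreal ((cmod (g N t - G t))\<^sup>2) \<partial>halfline) \<le> ennreal (1\<^sup>2)"
    by (intro fatou) auto
  also have "ennreal (1\<^sup>2) < \<infinity>" by simp
  finally have "square_integrable (\<lambda>t. g N t - G t)"
    unfolding square_integrable_nn_integral by (intro conjI) measurable
  then have "square_integrable (\<lambda>t. g N t + (-1) * (g N t - G t))"
    by (intro square_integrable_add square_integrable_scale) (simp_all add: g_def square_integrable_rep)
  then have G: "square_integrable G" by simp
  have dist: "ennreal ((dist (X (r n)) (abs_L2 G))\<^sup>2)
    = (\<integral>\<^sup>+t. ennreal ((cmod (g n t - G t))\<^sup>2) \<partial>halfline)" for n
    unfolding dist_nn_integral g_def
  proof (rule nn_integral_cong_AE)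
    show "AE t in halfline. ennreal ((cmod (rep_L2 (X (r n)) t - rep_L2 (abs_L2 G) t))\<^sup>2)
      = ennreal ((cmod (rep_L2 (X (r n)) t - G t))\<^sup>2)"
      using rep_abs_AE[OF G] by eventually_elim simp
  qed
  have "(X \<circ> r) \<longlonglongrightarrow> abs_L2 G"
  proof (rule metric_LIMSEQ_I)
    fix e :: real assume e: "e > 0"
    obtain N where N: "\<And>n m. n \<ge> N \<Longrightarrow> m \<ge> N \<Longrightarrow> dist (X (r n)) (X (r m)) < e / 2"
      using cauchy[of "e / 2"] e by auto
    have "dist (X (r n)) (abs_L2 G) \<le> e / 2" if "n \<ge> N" for n
    proof -
      have "ennreal ((dist (X (r n)) (abs_L2 G))\<^sup>2) \<le> ennreal ((e / 2)\<^sup>2)"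
        unfolding dist using N[OF that] by (rule fatou)
      then have "(dist (X (r n)) (abs_L2 G))\<^sup>2 \<le> (e / 2)\<^sup>2" by simp
      then show ?thesis by (rule power2_le_imp_le) (use e in simp)
    qed
    then show "\<exists>N. \<forall>n\<ge>N. dist ((X \<circ> r) n) (abs_L2 G) < e"
      using e by (intro exI[of _ N] allI impI) (simp add: le_less_trans[of _ "e / 2" e])
  qed
  then have "X \<longlonglongrightarrow> abs_L2 G" by (rule Cauchy_converges_subseq[OF X r])
  then show "convergent X" by (rule convergentI)
qed

section \<open>The Laplace transform as a square root of the Carleman operator\<close>

interpretation halfline: sigma_finite_measure halfline
  by (rule sigma_finite_measure_restrict_space) (auto intro: lborel.sigma_finite_measure_axioms)

interpretation halfline_pair: pair_sigma_finite halfline halfline ..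

lemma measurable_halfline_ident [measurable]: "(\<lambda>t. t) \<in> borel_measurable halfline"
  by (rule measurable_restrict_space1) simp

lemma measurable_halfline_fst [measurable]: "fst \<in> borel_measurable (halfline \<Otimes>\<^sub>M M)"
  by (rule measurable_compose[OF measurable_fst measurable_halfline_ident])

lemma measurable_halfline_snd [measurable]: "snd \<in> borel_measurable (M \<Otimes>\<^sub>M halfline)"
  by (rule measurable_compose[OF measurable_snd measurable_halfline_ident])

lemma space_halfline [simp]: "space halfline = {0<..}"
  by (simp add: space_restrict_space)

section \<open>Boundedness of the Laplace transform by a Schur test\<close>

text \<open>Rescaling \<open>t\<close> by \<open>x\<close> in Euler's integral. The exponent
  \<open>p = 1 / 2\<close> evaluates both integrals of the Schur test, and \<open>p = 1\<close>
  gives the integrals of plain exponentials.\<close>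

lemma nn_integral_halfline_Gamma:
  assumes p: "p > 0" and x: "x > 0"
  shows "(\<integral>\<^sup>+t. ennreal (t powr (p - 1) * exp (- (x * t))) \<partial>halfline) = ennreal (Gamma p * x powr - p)"
    (is "?I = _")
proof -
  have "ennreal (Gamma p) = (\<integral>\<^sup>+t. ennreal (indicator {0..} t * t powr (p - 1) / exp t) \<partial>lborel)"
    by (rule Gamma_conv_nn_integral_real[OF p])
  also have "\<dots> = ennreal x * (\<integral>\<^sup>+t. ennreal (indicator {0..} (x * t) * (x * t) powr (p - 1) / exp (x * t)) \<partial>lborel)"
    using x by (subst nn_integral_real_affine[where c = x and t = 0]) simp_all
  also have "(\<integral>\<^sup>+t. ennreal (indicator {0..} (x * t) * (x * t) powr (p - 1) / exp (x * t)) \<partial>lborel)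
    = (\<integral>\<^sup>+t. ennreal (x powr (p - 1)) * (ennreal (t powr (p - 1) * exp (- (x * t))) * indicator {0<..} t) \<partial>lborel)"
    using x by (intro nn_integral_cong)
      (auto simp: indicator_def powr_mult exp_minus field_simps zero_le_mult_iff ennreal_mult[symmetric])
  also have "\<dots> = ennreal (x powr (p - 1)) * ?I"
    by (subst nn_integral_restrict_space) (auto intro!: nn_integral_cmult)
  finally have "ennreal (Gamma p) = ennreal (x powr p) * ?I"
    using x by (simp add: mult.assoc[symmetric] ennreal_mult[symmetric] powr_mult_base)
  then have "ennreal (x powr - p) * ennreal (Gamma p) = (ennreal (x powr - p) * ennreal (x powr p)) * ?I"
    by (simp add: mult.assoc)
  also have "ennreal (x powr - p) * ennreal (x powr p) = 1"
    using x by (simp add: ennreal_mult[symmetric] powr_add[symmetric])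
  finally show ?thesis
    using x p by (simp add: ennreal_mult[symmetric] mult.commute)
qed

text \<open>Schur test with weights \<open>s powr (1 / 4)\<close>: Cauchy-Schwarz in
  \<open>s\<close> produces the factor \<open>G * x powr (- 1 / 2)\<close>, and integrating this
  against the remaining exponential in \<open>x\<close> produces
  \<open>G * s powr - (1 / 2)\<close>, which cancels the weight left on \<open>F\<close>. The
  absolute value stands inside the inner integral so that the bound also serves Fubini's theorem in
  \<open>integrable_laplace_kernel\<close>.\<close>

lemma laplace_Schur_bound:
  assumes [measurable]: "F \<in> borel_measurable halfline"
  shows "(\<integral>\<^sup>+x. (\<integral>\<^sup>+s. ennreal (exp (- (x * s)) * cmod (F s)) \<partial>halfline)\<^sup>2 \<partial>halfline)
    \<le> ennreal ((Gamma (1 / 2))\<^sup>2) * (\<integral>\<^sup>+s. ennreal ((cmod (F s))\<^sup>2) \<partial>halfline)"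
proof -
  define G where "G = Gamma (1 / 2 :: real)"
  have G: "G \<ge> 0" by (simp add: G_def)
  have "(\<integral>\<^sup>+s. ennreal (exp (- (x * s)) * cmod (F s)) \<partial>halfline)\<^sup>2
      \<le> (\<integral>\<^sup>+s. ennreal (G * (x powr (- 1 / 2) * exp (- (s * x))) * (s powr (1 / 2) * (cmod (F s))\<^sup>2)) \<partial>halfline)"
    if x: "x > 0" for x
  proof -
    \<comment> \<open>The exponential is halved between the two factors, and the powers of
      \<open>s\<close> cancel in the product \<open>u s * v s\<close>.\<close>
    define u where "u s = ennreal (exp (- (x * s) / 2) * s powr (- 1 / 4))" for s
    define v where "v s = ennreal (exp (- (x * s) / 2) * s powr (1 / 4) * cmod (F s))" for s
    have [measurable]: "u \<in> borel_measurable halfline" "v \<in> borel_measurable halfline"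
      unfolding u_def v_def by measurable
    have uv: "u s * v s = ennreal (exp (- (x * s)) * cmod (F s))" if "s > 0" for s
    proof -
      have "u s * v s = ennreal ((exp (- (x * s) / 2) * exp (- (x * s) / 2)) * (s powr (- 1 / 4) * s powr (1 / 4)) * cmod (F s))"
        by (simp add: u_def v_def ennreal_mult[symmetric] mult_ac)
      then show ?thesis using that by (simp add: mult_exp_exp powr_add[symmetric])
    qed
    have uu: "(u s)\<^sup>2 = ennreal (s powr (1 / 2 - 1) * exp (- (x * s)))" if "s > 0" for s
    proof -
      have "(u s)\<^sup>2 = ennreal ((exp (- (x * s) / 2) * exp (- (x * s) / 2)) * (s powr (- 1 / 4) * s powr (- 1 / 4)))"
        by (simp add: u_def power2_eq_square ennreal_mult[symmetric] mult_ac)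
      then show ?thesis using that by (simp add: mult_exp_exp powr_add[symmetric] mult.commute)
    qed
    have vv: "(v s)\<^sup>2 = ennreal (exp (- (s * x)) * (s powr (1 / 2) * (cmod (F s))\<^sup>2))" if "s > 0" for s
    proof -
      have "(v s)\<^sup>2 = ennreal ((exp (- (x * s) / 2) * exp (- (x * s) / 2)) * ((s powr (1 / 4) * s powr (1 / 4)) * (cmod (F s))\<^sup>2))"
        by (simp add: v_def power2_eq_square ennreal_mult[symmetric] mult_ac)
      then show ?thesis using that by (simp add: mult_exp_exp powr_add[symmetric] mult.commute)
    qed
    have "(\<integral>\<^sup>+s. ennreal (exp (- (x * s)) * cmod (F s)) \<partial>halfline)\<^sup>2 = (\<integral>\<^sup>+s. u s * v s \<partial>halfline)\<^sup>2"
      by (intro arg_cong[of _ _ "\<lambda>z. z\<^sup>2"] nn_integral_cong) (simp add: uv)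
    also have "\<dots> \<le> (\<integral>\<^sup>+s. (u s)\<^sup>2 \<partial>halfline) * (\<integral>\<^sup>+s. (v s)\<^sup>2 \<partial>halfline)"
      by (rule Cauchy_Schwarz_nn_integral) measurable
    also have "(\<integral>\<^sup>+s. (u s)\<^sup>2 \<partial>halfline) = ennreal (G * x powr (- 1 / 2))"
      using nn_integral_halfline_Gamma[of "1 / 2" x] x
      by (simp add: G_def uu cong: nn_integral_cong_simp)
    also have "(\<integral>\<^sup>+s. (v s)\<^sup>2 \<partial>halfline)
        = (\<integral>\<^sup>+s. ennreal (exp (- (s * x)) * (s powr (1 / 2) * (cmod (F s))\<^sup>2)) \<partial>halfline)"
      by (intro nn_integral_cong) (simp add: vv)
    also have "ennreal (G * x powr (- 1 / 2)) * \<dots>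
        = (\<integral>\<^sup>+s. ennreal (G * x powr (- 1 / 2)) * ennreal (exp (- (s * x)) * (s powr (1 / 2) * (cmod (F s))\<^sup>2)) \<partial>halfline)"
      by (intro nn_integral_cmult[symmetric]) measurable
    finally show ?thesis
      using G by (simp add: ennreal_mult[symmetric] mult_ac)
  qed
  then have "(\<integral>\<^sup>+x. (\<integral>\<^sup>+s. ennreal (exp (- (x * s)) * cmod (F s)) \<partial>halfline)\<^sup>2 \<partial>halfline)
    \<le> (\<integral>\<^sup>+x. \<integral>\<^sup>+s. ennreal (G * (x powr (- 1 / 2) * exp (- (s * x))) * (s powr (1 / 2) * (cmod (F s))\<^sup>2)) \<partial>halfline \<partial>halfline)"
    by (intro nn_integral_mono) simp
  also have "\<dots> = (\<integral>\<^sup>+s. \<integral>\<^sup>+x. ennreal (G * (x powr (- 1 / 2) * exp (- (s * x))) * (s powr (1 / 2) * (cmod (F s))\<^sup>2)) \<partial>halfline \<partial>halfline)"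
    by (rule halfline_pair.Fubini') measurable
  also have "\<dots> = (\<integral>\<^sup>+s. ennreal (G\<^sup>2) * ennreal ((cmod (F s))\<^sup>2) \<partial>halfline)"
  proof (rule nn_integral_cong)
    fix s assume "s \<in> space halfline"
    then have s: "s > 0" by simp
    have "(\<integral>\<^sup>+x. ennreal (G * (x powr (- 1 / 2) * exp (- (s * x))) * (s powr (1 / 2) * (cmod (F s))\<^sup>2)) \<partial>halfline)
      = (\<integral>\<^sup>+x. ennreal (G * (s powr (1 / 2) * (cmod (F s))\<^sup>2)) * ennreal (x powr (1 / 2 - 1) * exp (- (s * x))) \<partial>halfline)"
      using G s by (intro nn_integral_cong) (simp add: ennreal_mult[symmetric] mult_ac)
    also have "\<dots> = ennreal (G * (s powr (1 / 2) * (cmod (F s))\<^sup>2)) * ennreal (G * s powr - (1 / 2))"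
      using nn_integral_halfline_Gamma[of "1 / 2" s] s by (simp add: nn_integral_cmult G_def)
    also have "\<dots> = ennreal (G\<^sup>2 * ((s powr (1 / 2) * s powr - (1 / 2)) * (cmod (F s))\<^sup>2))"
      using G s by (simp add: ennreal_mult[symmetric] mult_ac power2_eq_square)
    also have "\<dots> = ennreal (G\<^sup>2) * ennreal ((cmod (F s))\<^sup>2)"
      using s by (simp add: powr_add[symmetric] ennreal_mult[symmetric])
    finally show "(\<integral>\<^sup>+x. ennreal (G * (x powr (- 1 / 2) * exp (- (s * x))) * (s powr (1 / 2) * (cmod (F s))\<^sup>2)) \<partial>halfline)
      = ennreal (G\<^sup>2) * ennreal ((cmod (F s))\<^sup>2)" .
  qed
  also have "\<dots> = ennreal (G\<^sup>2) * (\<integral>\<^sup>+s. ennreal ((cmod (F s))\<^sup>2) \<partial>halfline)"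
    by (rule nn_integral_cmult) measurable
  finally show ?thesis by (simp add: G_def)
qed

section \<open>The Laplace transform and its square\<close>

definition expo :: "real \<Rightarrow> L2" where
  "expo x = abs_L2 (\<lambda>s. complex_of_real (exp (- (x * s))))"

lemma square_integrable_exp:
  assumes "x > 0"
  shows "square_integrable (\<lambda>s. complex_of_real (exp (- (x * s))))"
proof -
  have "(\<integral>\<^sup>+s. ennreal ((cmod (complex_of_real (exp (- (x * s)))))\<^sup>2) \<partial>halfline)
      = (\<integral>\<^sup>+s. ennreal (s powr (1 - 1) * exp (- ((2 * x) * s))) \<partial>halfline)"
    by (intro nn_integral_cong) (simp add: power2_eq_square mult_exp_exp)
  also have "\<dots> < \<infinity>"
    using assms by (subst nn_integral_halfline_Gamma) auto
  finally show ?thesis by (simp add: square_integrable_nn_integral)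
qed

lemma cinner_expo:
  assumes "x > 0"
  shows "cinner f (expo x) = (\<integral>s. rep_L2 f s * complex_of_real (exp (- (x * s))) \<partial>halfline)"
  unfolding expo_def cinner_abs_right[OF square_integrable_exp[OF assms]] by simp

lemma integrable_rep_exp:
  assumes "x > 0"
  shows "integrable halfline (\<lambda>s. rep_L2 f s * complex_of_real (exp (- (x * s))))"
  using square_integrable_cinner[OF square_integrable_rep square_integrable_exp[OF assms], of f] by simp

text \<open>The Carleman kernel as Gram kernel of the exponentials; equivalently, the Laplace
  transform of \<open>expo x\<close> is the function with value \<open>1 / (x + y)\<close> at
  \<open>y\<close>.\<close>

lemma cinner_expo_expo:
  assumes "x > 0" "y > 0"
  shows "cinner (expo x) (expo y) = complex_of_real (1 / (x + y))"
proof -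
  have "cinner (expo x) (expo y) = (\<integral>s. complex_of_real (exp (- ((x + y) * s))) \<partial>halfline)"
    unfolding expo_def cinner_abs[OF square_integrable_exp square_integrable_exp, OF assms]
    by (simp add: mult_exp_exp of_real_mult[symmetric] algebra_simps del: of_real_mult)
  also have "\<dots> = complex_of_real (\<integral>s. exp (- ((x + y) * s)) \<partial>halfline)"
    by (rule integral_complex_of_real)
  also have "(\<integral>s. exp (- ((x + y) * s)) \<partial>halfline) = 1 / (x + y)"
  proof (rule integral_eq_nn_integral[THEN trans])
    have "(\<integral>\<^sup>+s. ennreal (exp (- ((x + y) * s))) \<partial>halfline)
      = (\<integral>\<^sup>+s. ennreal (s powr (1 - 1) * exp (- ((x + y) * s))) \<partial>halfline)"
      by (intro nn_integral_cong) simp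
    also have "\<dots> = ennreal (1 / (x + y))"
      using assms by (subst nn_integral_halfline_Gamma) (auto simp: powr_minus_divide)
    finally show "enn2real (\<integral>\<^sup>+s. ennreal (exp (- ((x + y) * s))) \<partial>halfline) = 1 / (x + y)"
      using assms by simp
  qed auto
  finally show ?thesis .
qed

definition laplace :: "L2 \<Rightarrow> L2" where
  "laplace f = abs_L2 (\<lambda>x. cinner f (expo x))"

lemma laplace_estimate:
  "(\<lambda>x. cinner f (expo x)) \<in> borel_measurable halfline"
  "(\<integral>\<^sup>+x. ennreal ((cmod (cinner f (expo x)))\<^sup>2) \<partial>halfline) \<le> ennreal ((Gamma (1 / 2) * norm f)\<^sup>2)"
proof -
  have "(\<lambda>x. \<integral>s. rep_L2 f s * complex_of_real (exp (- (x * s))) \<partial>halfline) \<in> borel_measurable halfline"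
    by measurable
  then show "(\<lambda>x. cinner f (expo x)) \<in> borel_measurable halfline"
    by (subst measurable_cong[where g = "\<lambda>x. \<integral>s. rep_L2 f s * complex_of_real (exp (- (x * s))) \<partial>halfline"])
      (simp_all add: cinner_expo)
  have "(\<integral>\<^sup>+x. ennreal ((cmod (cinner f (expo x)))\<^sup>2) \<partial>halfline)
     \<le> (\<integral>\<^sup>+x. (\<integral>\<^sup>+s. ennreal (exp (- (x * s)) * cmod (rep_L2 f s)) \<partial>halfline)\<^sup>2 \<partial>halfline)"
  proof (rule nn_integral_mono)
    fix x assume "x \<in> space halfline"
    then have x: "x > 0" by simp
    have "ennreal (cmod (cinner f (expo x))) \<le> (\<integral>\<^sup>+s. ennreal (exp (- (x * s)) * cmod (rep_L2 f s)) \<partial>halfline)"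
      using integral_norm_bound_ennreal[OF integrable_rep_exp[OF x, of f]]
      by (simp add: cinner_expo[OF x] norm_mult mult.commute)
    then show "ennreal ((cmod (cinner f (expo x)))\<^sup>2)
      \<le> (\<integral>\<^sup>+s. ennreal (exp (- (x * s)) * cmod (rep_L2 f s)) \<partial>halfline)\<^sup>2"
      by (simp add: ennreal_power[symmetric] power_mono)
  qed
  also have "\<dots> \<le> ennreal ((Gamma (1 / 2))\<^sup>2) * ennreal ((norm f)\<^sup>2)"
    unfolding norm_nn_integral by (rule laplace_Schur_bound) measurable
  finally show "(\<integral>\<^sup>+x. ennreal ((cmod (cinner f (expo x)))\<^sup>2) \<partial>halfline) \<le> ennreal ((Gamma (1 / 2) * norm f)\<^sup>2)"
    by (simp add: ennreal_mult[symmetric] power_mult_distrib)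
qed

lemma square_integrable_laplace: "square_integrable (\<lambda>x. cinner f (expo x))"
  using laplace_estimate[of f] by (auto simp: square_integrable_nn_integral intro: le_less_trans)

lemma norm_laplace_le: "norm (laplace f) \<le> Gamma (1 / 2) * norm f"
proof -
  have "ennreal ((norm (laplace f))\<^sup>2) \<le> ennreal ((Gamma (1 / 2) * norm f)\<^sup>2)"
    unfolding laplace_def norm_abs_nn_integral[OF square_integrable_laplace] by (rule laplace_estimate)
  then have "(norm (laplace f))\<^sup>2 \<le> (Gamma (1 / 2) * norm f)\<^sup>2" by simp
  then show ?thesis by (rule power2_le_imp_le) simp
qed

lemma clinear_op_laplace: "clinear_op laplace"
proof -
  have "laplace (f + g) = laplace f + laplace g" for f g
    using plus_L2.abs_eq[of "\<lambda>x. cinner f (expo x)" "\<lambda>x. cinner g (expo x)"]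
    by (simp add: laplace_def cinner_add_left ae_eq_refl square_integrable_laplace)
  moreover have "laplace (c *\<^sub>C f) = c *\<^sub>C laplace f" for c f
    using scaleC.abs_eq[of "\<lambda>x. cinner f (expo x)" c]
    by (simp add: laplace_def cinner_scaleC_left ae_eq_refl square_integrable_laplace)
  ultimately show ?thesis by (simp add: clinear_op_def)
qed

text \<open>Absolute integrability for Fubini's theorem: integrating over \<open>s\<close> first
  leaves the function \<open>A\<close>, which is square integrable by the Schur bound, paired with
  the square integrable \<open>g\<close>.\<close>

lemma integrable_laplace_kernel:
  "integrable (halfline \<Otimes>\<^sub>M halfline)
    (\<lambda>(s, x). rep_L2 f s * complex_of_real (exp (- (x * s))) * cnj (rep_L2 g x))"
proof (rule integrableI_bounded)
  have cnj_meas [measurable]: "cnj \<in> borel_measurable borel"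
    by (intro borel_measurable_continuous_onI continuous_intros)
  show "(\<lambda>(s, x). rep_L2 f s * complex_of_real (exp (- (x * s))) * cnj (rep_L2 g x))
    \<in> borel_measurable (halfline \<Otimes>\<^sub>M halfline)"
    by measurable
  define A where "A x = (\<integral>\<^sup>+s. ennreal (exp (- (x * s)) * cmod (rep_L2 f s)) \<partial>halfline)" for x
  have [measurable]: "A \<in> borel_measurable halfline" unfolding A_def by measurable
  have "(\<integral>\<^sup>+z. norm (case z of (s, x) \<Rightarrow> rep_L2 f s * complex_of_real (exp (- (x * s))) * cnj (rep_L2 g x)) \<partial>(halfline \<Otimes>\<^sub>M halfline))
    = (\<integral>\<^sup>+z. (case z of (s, x) \<Rightarrow> ennreal (exp (- (x * s)) * cmod (rep_L2 f s)) * ennreal (cmod (rep_L2 g x))) \<partial>(halfline \<Otimes>\<^sub>M halfline))"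
    by (intro nn_integral_cong) (auto simp: norm_mult ennreal_mult[symmetric] mult_ac)
  also have "\<dots> = (\<integral>\<^sup>+x. \<integral>\<^sup>+s. ennreal (exp (- (x * s)) * cmod (rep_L2 f s)) * ennreal (cmod (rep_L2 g x)) \<partial>halfline \<partial>halfline)"
    by (subst halfline_pair.nn_integral_snd[symmetric]) auto
  also have "\<dots> = (\<integral>\<^sup>+x. A x * ennreal (cmod (rep_L2 g x)) \<partial>halfline)"
    unfolding A_def by (intro nn_integral_cong nn_integral_multc) auto
  finally have eq: "(\<integral>\<^sup>+z. norm (case z of (s, x) \<Rightarrow> rep_L2 f s * complex_of_real (exp (- (x * s))) * cnj (rep_L2 g x)) \<partial>(halfline \<Otimes>\<^sub>M halfline))
    = (\<integral>\<^sup>+x. A x * ennreal (cmod (rep_L2 g x)) \<partial>halfline)" .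
  have "(\<integral>\<^sup>+x. A x * ennreal (cmod (rep_L2 g x)) \<partial>halfline)\<^sup>2
    \<le> (\<integral>\<^sup>+x. (A x)\<^sup>2 \<partial>halfline) * (\<integral>\<^sup>+x. (ennreal (cmod (rep_L2 g x)))\<^sup>2 \<partial>halfline)"
    by (rule Cauchy_Schwarz_nn_integral) measurable
  also have "\<dots> \<le> (ennreal ((Gamma (1 / 2))\<^sup>2) * ennreal ((norm f)\<^sup>2)) * ennreal ((norm g)\<^sup>2)"
    unfolding norm_nn_integral A_def by (intro mult_mono laplace_Schur_bound) (auto simp: ennreal_power)
  also have "\<dots> < \<infinity>" by (simp add: ennreal_mult_less_top)
  finally have "(\<integral>\<^sup>+x. A x * ennreal (cmod (rep_L2 g x)) \<partial>halfline)\<^sup>2 < \<infinity>" .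
  then show "(\<integral>\<^sup>+z. norm (case z of (s, x) \<Rightarrow> rep_L2 f s * complex_of_real (exp (- (x * s))) * cnj (rep_L2 g x)) \<partial>(halfline \<Otimes>\<^sub>M halfline)) < \<infinity>"
    unfolding eq by (simp add: power2_eq_square ennreal_mult_less_top less_top[symmetric] ennreal_mult_eq_top_iff)
qed

text \<open>The kernel \<open>exp (- (x * s))\<close> is real and symmetric, so exchanging the
  integrals moves the transform to the other argument.\<close>

lemma cinner_laplace: "cinner (laplace f) g = cinner f (laplace g)"
proof -
  have "cinner (laplace f) g = (\<integral>x. cinner f (expo x) * cnj (rep_L2 g x) \<partial>halfline)"
    using cinner_abs[OF square_integrable_laplace square_integrable_rep, of f g]
    by (simp add: laplace_def abs_rep_L2)
  also have "\<dots> = (\<integral>x. \<integral>s. rep_L2 f s * complex_of_real (exp (- (x * s))) * cnj (rep_L2 g x) \<partial>halfline \<partial>halfline)"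
    by (intro Bochner_Integration.integral_cong) (simp_all add: cinner_expo)
  also have "\<dots> = (\<integral>s. \<integral>x. rep_L2 f s * complex_of_real (exp (- (x * s))) * cnj (rep_L2 g x) \<partial>halfline \<partial>halfline)"
    by (rule halfline_pair.Fubini_integral[OF integrable_laplace_kernel])
  also have "\<dots> = (\<integral>s. rep_L2 f s * cnj (cinner g (expo s)) \<partial>halfline)"
  proof (intro Bochner_Integration.integral_cong refl)
    fix s assume "s \<in> space halfline"
    then have s: "s > 0" by simp
    have "(\<integral>x. rep_L2 f s * complex_of_real (exp (- (x * s))) * cnj (rep_L2 g x) \<partial>halfline)
      = (\<integral>x. rep_L2 f s * cnj (rep_L2 g x * complex_of_real (exp (- (s * x)))) \<partial>halfline)"
      by (intro Bochner_Integration.integral_cong) (simp_all add: mult_ac)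
    also have "\<dots> = rep_L2 f s * cnj (cinner g (expo s))"
      by (simp only: integral_mult_right_zero Bochner_Integration.integral_cnj cinner_expo[OF s])
    finally show "(\<integral>x. rep_L2 f s * complex_of_real (exp (- (x * s))) * cnj (rep_L2 g x) \<partial>halfline)
      = rep_L2 f s * cnj (cinner g (expo s))" .
  qed
  also have "\<dots> = cinner f (laplace g)"
    by (simp add: laplace_def cinner_abs_right square_integrable_laplace)
  finally show ?thesis .
qed

lemma self_adjoint_laplace: "self_adjoint laplace"
  using clinear_op_laplace norm_laplace_le cinner_laplace
  by (auto simp: self_adjoint_def bounded_operator_iff)

lemma square_integrable_cong:
  assumes "square_integrable F" "\<And>t. t > 0 \<Longrightarrow> F t = G t"
  shows "square_integrable G" and "abs_L2 F = abs_L2 G"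
proof -
  have "G \<in> borel_measurable halfline"
    using assms by (subst measurable_cong[of _ G F]) (auto simp: square_integrable_def)
  moreover have "integrable halfline (\<lambda>t. (cmod (G t))\<^sup>2)"
    using assms
    by (subst Bochner_Integration.integrable_cong[OF refl, of _ _ "\<lambda>t. (cmod (F t))\<^sup>2"]) (auto simp: square_integrable_def)
  ultimately show *: "square_integrable G" by (simp add: square_integrable_def)
  show "abs_L2 F = abs_L2 G"
    using assms * by (intro abs_L2_eqI) (auto simp: ae_eq_def intro!: AE_I2)
qed

text \<open>At \<open>t\<close> the double transform is
  \<open>(laplace f, expo t) = (f, laplace (expo t))\<close>, and the last pairing is the Hankel
  integral by \<open>cinner_expo_expo\<close>. Equality at every \<open>t > 0\<close> also shows
  that this integral is square integrable, so that \<open>abs_L2\<close> in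
  \<open>hankel_operator\<close> is applied to a genuine representative.\<close>

lemma carleman_eq_laplace_laplace: "carleman_operator f = laplace (laplace f)"
proof -
  have "cinner (laplace f) (expo t) = hankel_integral (\<lambda>t. complex_of_real (1 / t)) f t" if t: "t > 0" for t
  proof -
    have "cinner (laplace f) (expo t) = cinner f (laplace (expo t))" by (rule cinner_laplace)
    also have "\<dots> = (\<integral>s. rep_L2 f s * cnj (cinner (expo t) (expo s)) \<partial>halfline)"
      by (simp add: laplace_def cinner_abs_right square_integrable_laplace)
    also have "\<dots> = hankel_integral (\<lambda>t. complex_of_real (1 / t)) f t"
      unfolding hankel_integral_def
      by (intro Bochner_Integration.integral_cong) (use t in \<open>simp_all add: cinner_expo_expo mult.commute\<close>)
    finally show ?thesis .
  qed
  then show ?thesis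
    unfolding carleman_operator_def hankel_operator_def laplace_def[of "laplace f"]
    by (intro square_integrable_cong(2)[symmetric, OF square_integrable_laplace]) auto
qed

section \<open>Shifts\<close>

lemma AE_halfline_shift:
  assumes "AE t in halfline. P t" "0 \<le> c"
  shows "AE t in halfline. P (t + c)"
proof -
  have "AE t in lborel. 0 < t \<longrightarrow> P t"
    using assms(1) by (subst (asm) AE_restrict_space_iff) auto
  then have "AE t in distr lborel borel ((+) c). 0 < t \<longrightarrow> P t"
    by (simp only: lborel_distr_plus[of c])
  then have "AE t in lborel. 0 < c + t \<longrightarrow> P (c + t)"
    by (rule AE_distrD[rotated]) simp
  then have "AE t in lborel. 0 < t \<longrightarrow> P (t + c)"
    by eventually_elim (use assms(2) in \<open>auto simp: add.commute\<close>)
  then show ?thesis by (subst AE_restrict_space_iff) auto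
qed

text \<open>After extension by 0 to the whole line, the right shift on the half-line is an ordinary
  translation, under which \<open>lborel\<close> is invariant.\<close>

lemma indicator_shift:
  "indicator {0<..} t *\<^sub>R (if 1 < t then K (t - 1) else 0) = indicator {0<..} (t - 1 :: real) *\<^sub>R (K (t - 1) :: 'a :: real_vector)"
  by (auto simp: indicator_def)

lemma lborel_shift_measurable:
  fixes K :: "real \<Rightarrow> 'a :: {banach, second_countable_topology}"
  assumes "K \<in> borel_measurable halfline"
  shows "(\<lambda>t. if 1 < t then K (t - 1) else 0) \<in> borel_measurable halfline"
    and "(\<lambda>t. K (t + 1)) \<in> borel_measurable halfline"
proof -
  have [measurable]: "(\<lambda>t. indicator {0<..} t *\<^sub>R K t) \<in> borel_measurable lborel"
    using assms by (subst (asm) borel_measurable_restrict_space_iff) auto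
  have "(\<lambda>t. indicator {0<..} (t - 1) *\<^sub>R K (t - 1)) \<in> borel_measurable lborel"
    by (rule measurable_compose[of "\<lambda>t. t - 1" lborel lborel "\<lambda>t. indicator {0<..} t *\<^sub>R K t"]) measurable
  then show "(\<lambda>t. if 1 < t then K (t - 1) else 0) \<in> borel_measurable halfline"
    by (subst borel_measurable_restrict_space_iff) (simp_all add: indicator_shift)
  have "(\<lambda>t. indicator {0<..} (t + 1) *\<^sub>R K (t + 1)) \<in> borel_measurable lborel"
    by (rule measurable_compose[of "\<lambda>t. t + 1" lborel lborel "\<lambda>t. indicator {0<..} t *\<^sub>R K t"]) measurable
  then have "(\<lambda>t. indicator {0<..} t *\<^sub>R (indicator {0<..} (t + 1) *\<^sub>R K (t + 1))) \<in> borel_measurable lborel"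
    by measurable
  also have "(\<lambda>t. indicator {0<..} t *\<^sub>R (indicator {0<..} (t + 1) *\<^sub>R K (t + 1))) = (\<lambda>t. indicator {0<..} t *\<^sub>R K (t + 1))"
    by (auto simp: indicator_def fun_eq_iff)
  finally show "(\<lambda>t. K (t + 1)) \<in> borel_measurable halfline"
    by (subst borel_measurable_restrict_space_iff) simp_all
qed

lemma integral_halfline_shift:
  fixes K :: "real \<Rightarrow> 'a :: {banach, second_countable_topology}"
  shows "(\<integral>t. (if 1 < t then K (t - 1) else 0) \<partial>halfline) = (\<integral>t. K t \<partial>halfline)"
  using lborel_integral_real_affine[of 1 "\<lambda>t. indicator {0<..} t *\<^sub>R K t" "-1"]
  by (simp add: integral_restrict_space indicator_shift)

lemma integrable_halfline_shift:
  fixes K :: "real \<Rightarrow> 'a :: {banach, second_countable_topology}"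
  shows "integrable halfline (\<lambda>t. if 1 < t then K (t - 1) else 0) \<longleftrightarrow> integrable halfline K"
  using lborel_integrable_real_affine_iff[of 1 "\<lambda>t. indicator {0<..} t *\<^sub>R K t" "-1"]
  by (simp add: integrable_restrict_space indicator_shift)

lemma square_integrable_rshift:
  assumes "square_integrable F"
  shows "square_integrable (\<lambda>t. if 1 < t then F (t - 1) else 0)"
proof -
  have "integrable halfline (\<lambda>t. if 1 < t then (cmod (F (t - 1)))\<^sup>2 else 0)"
    using assms integrable_halfline_shift[of "\<lambda>t. (cmod (F t))\<^sup>2"] by (simp add: square_integrable_def)
  also have "(\<lambda>t. if 1 < t then (cmod (F (t - 1)))\<^sup>2 else 0) = (\<lambda>t. (cmod (if 1 < t then F (t - 1) else 0))\<^sup>2)"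
    by auto
  finally show ?thesis
    using assms lborel_shift_measurable(1)[of F] by (simp add: square_integrable_def)
qed

lemma square_integrable_lshift:
  assumes "square_integrable F"
  shows "square_integrable (\<lambda>t. F (t + 1))"
proof -
  have 1: "integrable halfline (\<lambda>t. indicator {1<..} t *\<^sub>R (cmod (F t))\<^sup>2)"
    using assms by (intro integrable_mult_indicator)
      (auto simp: square_integrable_def sets_restrict_space image_iff intro!: exI[of _ "{1<..}"])
  have "(\<lambda>t. indicator {1<..} t *\<^sub>R (cmod (F t))\<^sup>2) = (\<lambda>t. if 1 < t then (cmod (F ((t - 1) + 1)))\<^sup>2 else 0)"
    by (auto simp: indicator_def)
  with 1 have "integrable halfline (\<lambda>t. (cmod (F (t + 1)))\<^sup>2)"
    using integrable_halfline_shift[of "\<lambda>t. (cmod (F (t + 1)))\<^sup>2"] by simp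
  then show ?thesis
    using assms lborel_shift_measurable(2)[of F] by (simp add: square_integrable_def)
qed

definition rshift :: "L2 \<Rightarrow> L2" where
  "rshift f = abs_L2 (\<lambda>t. if 1 < t then rep_L2 f (t - 1) else 0)"

definition lshift :: "L2 \<Rightarrow> L2" where
  "lshift f = abs_L2 (\<lambda>t. rep_L2 f (t + 1))"

lemma cinner_rshift: "cinner (rshift f) g = cinner f (lshift g)"
proof -
  have "cinner (rshift f) g = (\<integral>t. (if 1 < t then rep_L2 f (t - 1) else 0) * cnj (rep_L2 g t) \<partial>halfline)"
    using cinner_abs[OF square_integrable_rshift[OF square_integrable_rep] square_integrable_rep, of f g]
    by (simp add: rshift_def abs_rep_L2)
  also have "\<dots> = (\<integral>t. (if 1 < t then rep_L2 f (t - 1) * cnj (rep_L2 g ((t - 1) + 1)) else 0) \<partial>halfline)"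
    by (intro Bochner_Integration.integral_cong) auto
  also have "\<dots> = (\<integral>t. rep_L2 f t * cnj (rep_L2 g (t + 1)) \<partial>halfline)"
    by (rule integral_halfline_shift)
  also have "\<dots> = cinner f (lshift g)"
    unfolding lshift_def by (rule cinner_abs_right[symmetric, OF square_integrable_lshift[OF square_integrable_rep]])
  finally show ?thesis .
qed

text \<open>By adjointness this eigenvalue becomes the multiplier in
  \<open>laplace_rshift\<close>.\<close>

lemma lshift_expo:
  assumes "x > 0"
  shows "lshift (expo x) = complex_of_real (exp (- x)) *\<^sub>C expo x"
proof (rule L2_eqI)
  have 1: "AE t in halfline. rep_L2 (lshift (expo x)) t = rep_L2 (expo x) (t + 1)"
    unfolding lshift_def by (rule rep_abs_AE[OF square_integrable_lshift[OF square_integrable_rep]])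
  have 2: "AE t in halfline. rep_L2 (expo x) t = complex_of_real (exp (- (x * t)))"
    unfolding expo_def by (rule rep_abs_AE[OF square_integrable_exp[OF assms]])
  show "AE t in halfline. rep_L2 (lshift (expo x)) t = rep_L2 (complex_of_real (exp (- x)) *\<^sub>C expo x) t"
    using 1 2 AE_halfline_shift[OF 2, of 1, simplified] rep_scaleC_AE[of "complex_of_real (exp (- x))" "expo x"]
    by eventually_elim (simp add: exp_add[symmetric] algebra_simps of_real_mult[symmetric] del: of_real_mult)
qed

text \<open>A Hankel kernel depends on \<open>t + s\<close> only, so a translation of
  \<open>s\<close> can be traded for one of \<open>t\<close>. This is where the Hankel structure of
  \<open>V\<close> enters: it makes the range of \<open>V\<close> invariant under
  \<open>lshift\<close>.\<close>

lemma hankel_operator_rshift: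
  assumes h: "hankel_kernel h"
  shows "hankel_operator h (rshift f) = lshift (hankel_operator h f)"
proof -
  have sq: "square_integrable (hankel_integral h f)" for f using h by (simp add: hankel_kernel_def)
  have hm: "h \<in> borel_measurable halfline" using h by (simp add: hankel_kernel_def)
  have rs: "AE s in halfline. rep_L2 (rshift f) s = (if 1 < s then rep_L2 f (s - 1) else 0)"
    unfolding rshift_def by (rule rep_abs_AE[OF square_integrable_rshift[OF square_integrable_rep]])
  have eq: "hankel_integral h (rshift f) t = hankel_integral h f (t + 1)" if t: "t > 0" for t
  proof -
    \<comment> \<open>The kernel is measurable on the half-line only, and \<open>t > 0\<close> keeps
      \<open>t + s\<close> inside it.\<close>
    have [measurable]: "(\<lambda>s. h (t + s)) \<in> borel_measurable halfline"
      by (rule measurable_compose[OF _ hm]) (use t in \<open>auto intro!: measurable_restrict_space3 simp: measurable_lborel1\<close>)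
    have [measurable]: "(\<lambda>s. if 1 < s then rep_L2 f (s - 1) else 0) \<in> borel_measurable halfline"
      by (rule lborel_shift_measurable) simp
    have "hankel_integral h (rshift f) t = (\<integral>s. h (t + s) * (if 1 < s then rep_L2 f (s - 1) else 0) \<partial>halfline)"
      unfolding hankel_integral_def
    proof (rule integral_cong_AE)
      show "AE s in halfline. h (t + s) * rep_L2 (rshift f) s = h (t + s) * (if 1 < s then rep_L2 f (s - 1) else 0)"
        using rs by eventually_elim simp
    qed measurable
    also have "\<dots> = (\<integral>s. (if 1 < s then h (t + 1 + (s - 1)) * rep_L2 f (s - 1) else 0) \<partial>halfline)"
      by (intro Bochner_Integration.integral_cong) auto
    also have "\<dots> = (\<integral>s. h (t + 1 + s) * rep_L2 f s \<partial>halfline)"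
      by (rule integral_halfline_shift)
    finally show ?thesis by (simp add: hankel_integral_def)
  qed
  have 1: "AE t in halfline. rep_L2 (hankel_operator h (rshift f)) t = hankel_integral h (rshift f) t"
    unfolding hankel_operator_def by (rule rep_abs_AE[OF sq])
  have 2: "AE t in halfline. rep_L2 (lshift (hankel_operator h f)) t = rep_L2 (hankel_operator h f) (t + 1)"
    unfolding lshift_def by (rule rep_abs_AE[OF square_integrable_lshift[OF square_integrable_rep]])
  have 3: "AE t in halfline. rep_L2 (hankel_operator h f) t = hankel_integral h f t"
    unfolding hankel_operator_def by (rule rep_abs_AE[OF sq])
  have 4: "AE t in halfline. t > 0" by (rule AE_I2) simp
  show ?thesis
    by (rule L2_eqI)
      (use 1 2 AE_halfline_shift[OF 3, of 1, simplified] 4 in \<open>eventually_elim, simp add: eq\<close>)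
qed

section \<open>Multiplication operators and polynomials in the right shift\<close>

definition bounded_symbol :: "(real \<Rightarrow> complex) \<Rightarrow> bool" where
  "bounded_symbol \<phi> \<longleftrightarrow> \<phi> \<in> borel_measurable halfline \<and> (\<exists>K. \<forall>t>0. cmod (\<phi> t) \<le> K)"

definition mult_op :: "(real \<Rightarrow> complex) \<Rightarrow> L2 \<Rightarrow> L2" where
  "mult_op \<phi> f = abs_L2 (\<lambda>t. \<phi> t * rep_L2 f t)"

lemma bounded_symbol_const: "bounded_symbol (\<lambda>t. c)"
  by (auto simp: bounded_symbol_def)

lemma bounded_symbol_mult:
  assumes "bounded_symbol \<phi>" "bounded_symbol \<psi>"
  shows "bounded_symbol (\<lambda>t. \<phi> t * \<psi> t)"
proof -
  obtain K M where "\<forall>t>0. cmod (\<phi> t) \<le> K" "\<forall>t>0. cmod (\<psi> t) \<le> M"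
    using assms by (auto simp: bounded_symbol_def)
  then have "\<forall>t>0. cmod (\<phi> t * \<psi> t) \<le> K * M"
    unfolding norm_mult by (meson mult_mono norm_ge_zero order_trans)
  then show ?thesis using assms by (auto simp: bounded_symbol_def)
qed

lemma bounded_symbol_add:
  assumes "bounded_symbol \<phi>" "bounded_symbol \<psi>"
  shows "bounded_symbol (\<lambda>t. \<phi> t + \<psi> t)"
proof -
  obtain K M where "\<forall>t>0. cmod (\<phi> t) \<le> K" "\<forall>t>0. cmod (\<psi> t) \<le> M"
    using assms by (auto simp: bounded_symbol_def)
  then have "\<forall>t>0. cmod (\<phi> t + \<psi> t) \<le> K + M"
    by (meson add_mono norm_triangle_le)
  then show ?thesis using assms by (auto simp: bounded_symbol_def)
qed

lemma bounded_symbol_diff: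
  assumes "bounded_symbol \<phi>" "bounded_symbol \<psi>"
  shows "bounded_symbol (\<lambda>t. \<phi> t - \<psi> t)"
  using bounded_symbol_add[OF assms(1) bounded_symbol_mult[OF bounded_symbol_const[of "-1"] assms(2)]]
  by simp

lemma bounded_symbol_power: "bounded_symbol \<phi> \<Longrightarrow> bounded_symbol (\<lambda>t. \<phi> t ^ n)"
  by (induction n) (auto intro: bounded_symbol_const bounded_symbol_mult)

lemma bounded_symbol_sum:
  "(\<And>i. i \<in> I \<Longrightarrow> bounded_symbol (\<phi> i)) \<Longrightarrow> bounded_symbol (\<lambda>t. \<Sum>i\<in>I. \<phi> i t)"
  by (induction I rule: infinite_finite_induct) (auto intro: bounded_symbol_const bounded_symbol_add)

lemma bounded_symbol_exp: "bounded_symbol (\<lambda>t. complex_of_real (exp (- t)))"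
  by (auto simp: bounded_symbol_def intro!: exI[of _ 1])

lemmas bounded_symbol_intros = bounded_symbol_const bounded_symbol_mult bounded_symbol_add
  bounded_symbol_diff bounded_symbol_power bounded_symbol_sum bounded_symbol_exp

lemma square_integrable_mult:
  assumes "bounded_symbol \<phi>" "square_integrable F"
  shows "square_integrable (\<lambda>t. \<phi> t * F t)"
proof -
  have [measurable]: "\<phi> \<in> borel_measurable halfline" "F \<in> borel_measurable halfline"
    using assms by (auto simp: bounded_symbol_def square_integrable_def)
  obtain K where K: "\<forall>t>0. cmod (\<phi> t) \<le> K"
    using assms by (auto simp: bounded_symbol_def)
  have "integrable halfline (\<lambda>t. (cmod (\<phi> t * F t))\<^sup>2)"
  proof (rule Bochner_Integration.integrable_bound)
    show "integrable halfline (\<lambda>t. K\<^sup>2 * (cmod (F t))\<^sup>2)"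
      using assms by (simp add: square_integrable_def)
    show "AE t in halfline. norm ((cmod (\<phi> t * F t))\<^sup>2) \<le> norm (K\<^sup>2 * (cmod (F t))\<^sup>2)"
      using K by (intro AE_I2) (simp add: norm_mult power_mult_distrib mult_right_mono power_mono)
  qed measurable
  then show ?thesis by (simp add: square_integrable_def)
qed

lemma rep_mult_op_AE:
  "bounded_symbol \<phi> \<Longrightarrow> AE t in halfline. rep_L2 (mult_op \<phi> f) t = \<phi> t * rep_L2 f t"
  unfolding mult_op_def by (intro rep_abs_AE square_integrable_mult square_integrable_rep)

lemma mult_op_mult_op:
  assumes "bounded_symbol \<phi>" "bounded_symbol \<psi>"
  shows "mult_op \<phi> (mult_op \<psi> f) = mult_op (\<lambda>t. \<phi> t * \<psi> t) f"
  by (rule L2_eqI)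
    (use rep_mult_op_AE[OF assms(1), of "mult_op \<psi> f"] rep_mult_op_AE[OF assms(2), of f]
      rep_mult_op_AE[OF bounded_symbol_mult[OF assms], of f] in \<open>eventually_elim, simp\<close>)

lemma mult_op_add_symbol:
  assumes "bounded_symbol \<phi>" "bounded_symbol \<psi>"
  shows "mult_op (\<lambda>t. \<phi> t + \<psi> t) f = mult_op \<phi> f + mult_op \<psi> f"
  by (rule L2_eqI)
    (use rep_mult_op_AE[OF assms(1), of f] rep_mult_op_AE[OF assms(2), of f]
      rep_mult_op_AE[OF bounded_symbol_add[OF assms], of f] rep_add_AE[of "mult_op \<phi> f" "mult_op \<psi> f"]
      in \<open>eventually_elim, simp add: distrib_right\<close>)

lemma mult_op_scale_symbol:
  assumes "bounded_symbol \<phi>"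
  shows "mult_op (\<lambda>t. c * \<phi> t) f = c *\<^sub>C mult_op \<phi> f"
  by (rule L2_eqI)
    (use rep_mult_op_AE[OF assms, of f] rep_scaleC_AE[of c "mult_op \<phi> f"]
      rep_mult_op_AE[OF bounded_symbol_mult[OF bounded_symbol_const assms], of c f]
      in \<open>eventually_elim, simp\<close>)

lemma mult_op_1: "mult_op (\<lambda>t. 1) f = f"
  by (simp add: mult_op_def abs_rep_L2)

lemma mult_op_0: "mult_op (\<lambda>t. 0) f = 0"
  using mult_op_scale_symbol[OF bounded_symbol_const[of 1], of 0 f] by simp

lemma mult_op_sum_symbol:
  "(\<And>i. i \<in> I \<Longrightarrow> bounded_symbol (\<phi> i)) \<Longrightarrow>
    mult_op (\<lambda>t. \<Sum>i\<in>I. \<phi> i t) f = (\<Sum>i\<in>I. mult_op (\<phi> i) f)"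
  by (induction I rule: infinite_finite_induct)
    (auto simp: mult_op_0 mult_op_add_symbol bounded_symbol_sum)

lemma laplace_rshift: "laplace (rshift f) = mult_op (\<lambda>t. complex_of_real (exp (- t))) (laplace f)"
proof (rule L2_eqI)
  have 1: "AE x in halfline. rep_L2 (laplace (rshift f)) x = cinner (rshift f) (expo x)"
    unfolding laplace_def by (rule rep_abs_AE[OF square_integrable_laplace])
  have 2: "AE x in halfline. rep_L2 (laplace f) x = cinner f (expo x)"
    unfolding laplace_def by (rule rep_abs_AE[OF square_integrable_laplace])
  have 3: "AE x in halfline. x > 0" by (rule AE_I2) simp
  show "AE x in halfline. rep_L2 (laplace (rshift f)) x
    = rep_L2 (mult_op (\<lambda>t. complex_of_real (exp (- t))) (laplace f)) x"
    using 1 2 3 rep_mult_op_AE[OF bounded_symbol_exp, of "laplace f"]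
    by eventually_elim (simp add: cinner_rshift lshift_expo cinner_simps)
qed

lemma laplace_rshift_poly:
  "laplace (\<Sum>i\<in>I. c i *\<^sub>C (rshift ^^ i) f) =
    mult_op (\<lambda>t. \<Sum>i\<in>I. c i * complex_of_real (exp (- t)) ^ i) (laplace f)"
proof -
  have pow: "laplace ((rshift ^^ i) f) = mult_op (\<lambda>t. complex_of_real (exp (- t)) ^ i) (laplace f)" for i
  proof (induction i)
    case (Suc i)
    then show ?case
      by (simp add: laplace_rshift mult_op_mult_op bounded_symbol_intros)
  qed (simp add: mult_op_1)
  show ?thesis
    by (simp add: clinear_op_sum[OF clinear_op_laplace] clinear_op_scaleC[OF clinear_op_laplace] pow
        mult_op_sum_symbol mult_op_scale_symbol bounded_symbol_intros)
qed

text \<open>Dominated convergence with majorant \<open>|g|^2\<close>. The convergence is for each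
  fixed \<open>g\<close>: the supremum of \<open>|\<phi>|\<close> may be 1, and then the operator
  norms of the powers do not tend to 0.\<close>

lemma tendsto_mult_op_power:
  assumes \<phi>: "bounded_symbol \<phi>" and le: "\<And>t. t > 0 \<Longrightarrow> cmod (\<phi> t) \<le> 1"
    and less: "AE t in halfline. cmod (\<phi> t) < 1"
  shows "(\<lambda>n. mult_op (\<lambda>t. \<phi> t ^ n) g) \<longlonglongrightarrow> 0"
proof -
  have [measurable]: "\<phi> \<in> borel_measurable halfline" using \<phi> by (simp add: bounded_symbol_def)
  have "(\<lambda>n. \<integral>\<^sup>+t. ennreal ((cmod (\<phi> t ^ n * rep_L2 g t))\<^sup>2) \<partial>halfline) \<longlonglongrightarrow> (\<integral>\<^sup>+t. 0 \<partial>halfline)"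
  proof (rule nn_integral_dominated_convergence[where w = "\<lambda>t. ennreal ((cmod (rep_L2 g t))\<^sup>2)"])
    show "(\<integral>\<^sup>+t. ennreal ((cmod (rep_L2 g t))\<^sup>2) \<partial>halfline) < \<infinity>"
      using norm_nn_integral[of g, symmetric] by simp
    show "AE t in halfline. ennreal ((cmod (\<phi> t ^ n * rep_L2 g t))\<^sup>2) \<le> ennreal ((cmod (rep_L2 g t))\<^sup>2)" for n
      using le by (intro AE_I2 ennreal_leI power_mono) (simp_all add: norm_mult norm_power mult_left_le_one_le power_le_one)
    show "AE t in halfline. (\<lambda>n. ennreal ((cmod (\<phi> t ^ n * rep_L2 g t))\<^sup>2)) \<longlonglongrightarrow> 0"
      using less
    proof eventually_elim
      case (elim t)
      then have "(\<lambda>n. (cmod (\<phi> t) ^ n * cmod (rep_L2 g t))\<^sup>2) \<longlonglongrightarrow> (0 * cmod (rep_L2 g t))\<^sup>2"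
        by (intro tendsto_intros LIMSEQ_power_zero) simp
      then have "(\<lambda>n. (cmod (\<phi> t ^ n * rep_L2 g t))\<^sup>2) \<longlonglongrightarrow> 0"
        by (simp add: norm_mult norm_power)
      then show ?case using tendsto_ennrealI by fastforce
    qed
  qed measurable
  moreover have "(\<integral>\<^sup>+t. ennreal ((cmod (\<phi> t ^ n * rep_L2 g t))\<^sup>2) \<partial>halfline)
      = ennreal ((norm (mult_op (\<lambda>t. \<phi> t ^ n) g))\<^sup>2)" for n
    unfolding mult_op_def
    by (rule norm_abs_nn_integral[symmetric])
      (intro square_integrable_mult bounded_symbol_power \<phi> square_integrable_rep)
  ultimately have "(\<lambda>n. ennreal ((norm (mult_op (\<lambda>t. \<phi> t ^ n) g))\<^sup>2)) \<longlonglongrightarrow> ennreal 0"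
    by simp
  then have "(\<lambda>n. (norm (mult_op (\<lambda>t. \<phi> t ^ n) g))\<^sup>2) \<longlonglongrightarrow> 0"
    by (subst (asm) tendsto_ennreal_iff) auto
  then have "(\<lambda>n. sqrt ((norm (mult_op (\<lambda>t. \<phi> t ^ n) g))\<^sup>2)) \<longlonglongrightarrow> sqrt 0"
    by (rule tendsto_real_sqrt)
  then have "(\<lambda>n. norm (mult_op (\<lambda>t. \<phi> t ^ n) g)) \<longlonglongrightarrow> 0" by simp
  then show ?thesis by (rule tendsto_norm_zero_cancel)
qed

text \<open>A nonzero polynomial has finitely many roots, and by injectivity of \<open>exp\<close>
  each of them is attained for at most one \<open>t\<close>.\<close>

lemma AE_exp_polynomial_nonzero:
  assumes "k \<le> n" "c k \<noteq> 0"
  shows "AE t in halfline. (\<Sum>i\<le>n. c i * complex_of_real (exp (- t)) ^ i) \<noteq> 0"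
proof -
  define Z where "Z = {z. (\<Sum>i\<le>n. c i * z ^ i) = (0::complex)}"
  have "finite Z"
    using assms polyfun_finite_roots[of c n] by (auto simp: Z_def)
  then have "finite ((\<lambda>t. complex_of_real (exp (- t))) -` Z)"
    by (rule finite_vimageI) (auto intro: injI)
  then have "(\<lambda>t. complex_of_real (exp (- t))) -` Z \<in> null_sets lborel"
    by (rule finite_imp_null_set_lborel)
  then have "AE t in lborel. t \<notin> (\<lambda>t. complex_of_real (exp (- t))) -` Z"
    by (rule AE_not_in)
  then have "AE t in lborel. 0 < t \<longrightarrow> (\<Sum>i\<le>n. c i * complex_of_real (exp (- t)) ^ i) \<noteq> 0"
    by eventually_elim (auto simp: Z_def)
  then show ?thesis by (subst AE_restrict_space_iff) auto
qed

text \<open>A vector annihilated by a polynomial in the left shift is annihilated in the weak sense by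
  \<open>q(rshift)\<close>, where \<open>q\<close> has the conjugate coefficients.  Hence the map \<open>\<Psi> = 1 - \<epsilon> q(rshift) p(rshift)\<close> does
  not change the pairing with \<open>u\<close>, whereas on the Laplace side it is multiplication by
  \<open>1 - \<epsilon> |p(exp(-t))|^2\<close>, whose powers tend strongly to \<open>0\<close>.\<close>

lemma laplace_dominated_eq_0:
  assumes k: "k \<le> n" "c k \<noteq> 0" and rel: "(\<Sum>i\<le>n. c i *\<^sub>C (lshift ^^ i) u) = 0"
    and dom: "\<And>f. cmod (cinner f u) \<le> C * norm (laplace f)"
  shows "u = 0"
proof -
  define e where "e t = complex_of_real (exp (- t))" for t
  define p where "p t = (\<Sum>i\<le>n. c i * e t ^ i)" for t
  define P where "P f = (\<Sum>i\<le>n. c i *\<^sub>C (rshift ^^ i) f)" for f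
  define Q where "Q f = (\<Sum>i\<le>n. cnj (c i) *\<^sub>C (rshift ^^ i) f)" for f
  define K where "K = (\<Sum>i\<le>n. cmod (c i))"
  \<comment> \<open>For \<open>t > 0\<close> the powers of \<open>e t\<close> have modulus at most
    1, so \<open>K\<close> bounds \<open>|p t|\<close>. This choice of \<open>\<epsilon>\<close>
    therefore places \<open>\<phi> t\<close> in the interval from 0 to 1, below 1 wherever
    \<open>p t\<close> is nonzero.\<close>
  define \<epsilon> where "\<epsilon> = 1 / K\<^sup>2"
  define \<Psi> where "\<Psi> f = f - complex_of_real \<epsilon> *\<^sub>C Q (P f)" for f
  define \<phi> where "\<phi> t = 1 - complex_of_real \<epsilon> * (cnj (p t) * p t)" for t
  have "0 < cmod (c k)" using k by simp
  also have "\<dots> \<le> K" unfolding K_def by (rule member_le_sum) (use k in auto)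
  finally have K: "K > 0" .
  have cnjp: "cnj (p t) = (\<Sum>i\<le>n. cnj (c i) * e t ^ i)" for t
    by (simp add: p_def e_def)
  have sym: "bounded_symbol p" "bounded_symbol (\<lambda>t. cnj (p t))"
    unfolding cnjp unfolding p_def e_def by (intro bounded_symbol_intros)+
  then have sym2: "bounded_symbol (\<lambda>t. cnj (p t) * p t)"
    by (intro bounded_symbol_mult)
  then have sym\<phi>: "bounded_symbol \<phi>"
    unfolding \<phi>_def by (intro bounded_symbol_diff bounded_symbol_mult[OF bounded_symbol_const] bounded_symbol_const)
  have adj: "cinner ((rshift ^^ i) f) g = cinner f ((lshift ^^ i) g)" for i f g
    by (induction i arbitrary: g) (simp_all add: cinner_rshift funpow_swap1[of lshift])
  \<comment> \<open>Conjugate linearity in the second argument of \<open>cinner\<close> turns the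
    coefficients \<open>cnj (c i)\<close> of \<open>Q\<close> back into \<open>c i\<close>, so the
    given relation applies.\<close>
  have "cinner (Q f) u = cinner f (\<Sum>i\<le>n. c i *\<^sub>C (lshift ^^ i) u)" for f
    by (simp add: Q_def cinner_sum_left cinner_sum_right cinner_simps adj)
  then have Q0: "cinner (Q f) u = 0" for f using rel by simp
  then have \<Psi>u: "cinner (\<Psi> f) u = cinner f u" for f by (simp add: \<Psi>_def cinner_simps)
  have \<Psi>nu: "cinner ((\<Psi> ^^ m) f) u = cinner f u" for m f
    by (induction m) (simp_all add: \<Psi>u)
  have LP: "laplace (P f) = mult_op p (laplace f)" for f
    unfolding P_def laplace_rshift_poly p_def e_def ..
  have LQ: "laplace (Q f) = mult_op (\<lambda>t. cnj (p t)) (laplace f)" for f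
    unfolding Q_def laplace_rshift_poly cnjp e_def ..
  have L\<Psi>: "laplace (\<Psi> f) = mult_op \<phi> (laplace f)" for f
  proof -
    have "mult_op \<phi> (laplace f) = mult_op (\<lambda>t. 1 + (- complex_of_real \<epsilon>) * (cnj (p t) * p t)) (laplace f)"
      unfolding \<phi>_def by simp
    also have "\<dots> = laplace f + (- complex_of_real \<epsilon>) *\<^sub>C laplace (Q (P f))"
      unfolding mult_op_add_symbol[OF bounded_symbol_const bounded_symbol_mult[OF bounded_symbol_const sym2]]
        mult_op_scale_symbol[OF sym2] LQ LP mult_op_mult_op[OF sym(2,1)] mult_op_1 ..
    also have "\<dots> = laplace (\<Psi> f)"
      by (simp add: \<Psi>_def clinear_op_diff[OF clinear_op_laplace] clinear_op_scaleC[OF clinear_op_laplace])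
    finally show ?thesis ..
  qed
  have L\<Psi>n: "laplace ((\<Psi> ^^ m) f) = mult_op (\<lambda>t. \<phi> t ^ m) (laplace f)" for m f
    by (induction m) (simp_all add: mult_op_1 L\<Psi> mult_op_mult_op sym\<phi> bounded_symbol_intros)
  have \<phi>_real: "\<phi> t = complex_of_real (1 - \<epsilon> * (cmod (p t))\<^sup>2)" for t
    unfolding \<phi>_def mult.commute[of "cnj (p t)"] by (simp add: complex_norm_square[symmetric] del: of_real_power)
  have p_le: "\<epsilon> * (cmod (p t))\<^sup>2 \<le> 1" if "t > 0" for t
  proof -
    have "cmod (p t) \<le> (\<Sum>i\<le>n. cmod (c i * e t ^ i))" unfolding p_def by (rule norm_sum)
    also have "\<dots> \<le> K"
      unfolding K_def using that
      by (intro sum_mono) (auto simp: e_def norm_mult norm_power intro!: mult_left_le power_le_one)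
    finally have "(cmod (p t))\<^sup>2 \<le> K\<^sup>2" by (rule power_mono) simp
    then show ?thesis using K by (simp add: \<epsilon>_def field_simps)
  qed
  have \<epsilon>: "\<epsilon> > 0" using K by (simp add: \<epsilon>_def)
  have pos: "AE t in halfline. t > 0" by (rule AE_I2) simp
  have "(\<lambda>m. mult_op (\<lambda>t. \<phi> t ^ m) g) \<longlonglongrightarrow> 0" for g
  proof (rule tendsto_mult_op_power[OF sym\<phi>])
    show "cmod (\<phi> t) \<le> 1" if "t > 0" for t
      unfolding \<phi>_real norm_of_real using p_le[OF that] \<epsilon> by (simp add: abs_le_iff)
    show "AE t in halfline. cmod (\<phi> t) < 1"
      using AE_exp_polynomial_nonzero[of k n c, OF k] pos
    proof eventually_elim
      case (elim t)
      then have "p t \<noteq> 0" by (simp add: p_def e_def)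
      then have "\<epsilon> * (cmod (p t))\<^sup>2 > 0" using \<epsilon> by simp
      then show ?case unfolding \<phi>_real norm_of_real using p_le[OF elim(2)] by linarith
    qed
  qed
  then have lim: "(\<lambda>m. C * norm (laplace ((\<Psi> ^^ m) f))) \<longlonglongrightarrow> C * 0" for f
    unfolding L\<Psi>n by (intro tendsto_intros tendsto_norm_zero)
  \<comment> \<open>Domination is applied to the iterates of \<open>\<Psi>\<close>: the left side
    stays fixed while the right side tends to 0. Hence \<open>u\<close> is orthogonal to every
    \<open>f\<close>, in particular to itself.\<close>
  have "cmod (cinner f u) \<le> C * norm (laplace ((\<Psi> ^^ m) f))" for f m
    using dom[of "(\<Psi> ^^ m) f"] by (simp add: \<Psi>nu)
  then have "cmod (cinner f u) \<le> C * 0" for f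
    by (intro LIMSEQ_le_const[OF lim[of f]]) blast
  from this[of u] show "u = 0" by (simp add: cinner_self_eq_0)
qed

section \<open>The negative spectrum of a finite-rank perturbation of a nonnegative operator\<close>

text \<open>The Lax-Milgram argument: solutions of \<open>T f = g\<close> are the fixed points of
  \<open>f - \<tau> (T f - g)\<close>, a contraction for small \<open>\<tau>\<close>. Coercivity
  also bounds \<open>T\<close> from below, which gives injectivity and the bound on the
  inverse.\<close>

lemma coercive_inverse:
  assumes T: "bounded_operator T" and \<delta>: "\<delta> > 0" and coer: "\<And>f. \<delta> * (norm f)\<^sup>2 \<le> inner (T f) f"
  obtains R where "bounded_operator R" "\<And>f. R (T f) = f" "\<And>f. T (R f) = f"
proof -
  obtain C0 where C0: "C0 > 0" "\<And>f. norm (T f) \<le> C0 * norm f"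
    using bounded_operatorE[OF T] by blast
  \<comment> \<open>Adding \<open>\<delta>\<close> ensures \<open>\<delta> / C < 1\<close>, so that
    the number under the root in \<open>q\<close> is positive.\<close>
  define C where "C = C0 + \<delta>"
  have C: "C > 0" "C > \<delta>" using C0 \<delta> by (auto simp: C_def)
  have TC: "norm (T f) \<le> C * norm f" for f
    using C0(2)[of f] \<delta> by (simp add: C_def distrib_right add_increasing2)
  have lin: "clinear_op T" using T by (rule bounded_operator_clinear)
  \<comment> \<open>This value minimises the contraction factor
    \<open>1 - 2 * \<tau> * \<delta> + \<tau>^2 * C^2\<close>.\<close>
  define \<tau> where "\<tau> = \<delta> / C\<^sup>2"
  define q where "q = sqrt (1 - (\<delta> / C)\<^sup>2)"
  have dC: "(\<delta> / C)\<^sup>2 < 1" "(\<delta> / C)\<^sup>2 > 0" using C \<delta> by (auto simp: power_less_one_iff abs_square_less_1)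
  have q: "0 \<le> q" "q < 1" using dC by (auto simp: q_def)
  have contr: "norm (h - \<tau> *\<^sub>R T h) \<le> q * norm h" for h
  proof -
    have "(norm (h - \<tau> *\<^sub>R T h))\<^sup>2 = (norm h)\<^sup>2 - 2 * \<tau> * inner (T h) h + \<tau>\<^sup>2 * (norm (T h))\<^sup>2"
      unfolding power2_norm_eq_inner
      by (simp add: inner_diff_left inner_diff_right inner_commute[of h "T h"] power2_eq_square algebra_simps)
    also have "\<dots> \<le> (norm h)\<^sup>2 - 2 * \<tau> * (\<delta> * (norm h)\<^sup>2) + \<tau>\<^sup>2 * (C * norm h)\<^sup>2"
      using \<delta> C coer[of h] TC[of h]
      by (intro add_mono diff_mono mult_left_mono power_mono order_refl) (auto simp: \<tau>_def)
    also have "\<dots> = (1 - 2 * \<tau> * \<delta> + \<tau>\<^sup>2 * C\<^sup>2) * (norm h)\<^sup>2"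
      by (simp add: power_mult_distrib algebra_simps)
    also have "1 - 2 * \<tau> * \<delta> + \<tau>\<^sup>2 * C\<^sup>2 = 1 - (\<delta> / C)\<^sup>2"
      using C by (simp add: \<tau>_def power2_eq_square field_simps)
    also have "\<dots> * (norm h)\<^sup>2 = (q * norm h)\<^sup>2"
      using dC by (simp add: q_def power_mult_distrib)
    finally show ?thesis by (rule power2_le_imp_le) (use q in simp)
  qed
  have surj: "\<exists>f. T f = g" for g
  proof -
    define \<Phi> where "\<Phi> f = f - \<tau> *\<^sub>R (T f - g)" for f
    have "dist (\<Phi> f) (\<Phi> h) \<le> q * dist f h" for f h
    proof -
      have "\<Phi> f - \<Phi> h = (f - h) - \<tau> *\<^sub>R T (f - h)"
        by (simp add: \<Phi>_def clinear_op_diff[OF lin] algebra_simps)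
      then show ?thesis using contr[of "f - h"] by (simp add: dist_norm)
    qed
    then obtain f where "\<Phi> f = f" using banach_fix_type[OF q, of \<Phi>] by auto
    then have "\<tau> *\<^sub>R (T f - g) = 0" by (simp add: \<Phi>_def)
    then show ?thesis using \<delta> C by (auto simp: \<tau>_def)
  qed
  then obtain R where R: "\<And>g. T (R g) = g" by metis
  have bound: "\<delta> * norm f \<le> norm (T f)" for f
  proof (cases "f = 0")
    case False
    have "\<delta> * norm f * norm f \<le> norm (T f) * norm f"
      using coer[of f] norm_cauchy_schwarz[of "T f" f] by (simp add: power2_eq_square)
    then show ?thesis using False by simp
  qed (simp add: clinear_op_0[OF lin])
  have inj: "f = h" if "T f = T h" for f h
    using bound[of "f - h"] that \<delta> by (simp add: clinear_op_diff[OF lin] mult_le_0_iff)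
  have "clinear_op R"
    unfolding clinear_op_def
    by (intro conjI allI; rule inj; simp add: R clinear_op_add[OF lin] clinear_op_scaleC[OF lin])
  moreover have "norm (R f) \<le> (1 / \<delta>) * norm f" for f
    using bound[of "R f"] \<delta> by (simp add: R field_simps)
  ultimately have "bounded_operator R" unfolding bounded_operator_iff by blast
  moreover have "R (T f) = f" for f by (rule inj) (rule R)
  ultimately show ?thesis using R by (rule that)
qed

text \<open>Subtracting the negative number \<open>x\<close> makes the form coercive with constant
  \<open>- x\<close>.\<close>

lemma shifted_nonneg_inverse:
  assumes A: "bounded_operator A" "\<And>f. 0 \<le> inner (A f) f" and x: "x < 0"
  shows "\<exists>R. bounded_operator R \<and> (\<forall>f. R (A f - complex_of_real x *\<^sub>C f) = f) \<and>
    (\<forall>f. A (R f) - complex_of_real x *\<^sub>C R f = f)"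
proof -
  have 1: "bounded_operator (\<lambda>f. A f - complex_of_real x *\<^sub>C f)"
    by (intro bounded_operator_minus bounded_operator_scale bounded_operator_id A)
  have 2: "- x > 0" using x by simp
  have 3: "- x * (norm f)\<^sup>2 \<le> inner (A f - complex_of_real x *\<^sub>C f) f" for f
    using A(2)[of f] by (simp add: inner_diff_left scaleR_eq_scaleC[symmetric] power2_norm_eq_inner)
  show ?thesis
    by (rule coercive_inverse[OF 1 2 3], rule exI) (intro conjI allI, assumption+)
qed

section \<open>Existence of negative eigenvectors by minimisation\<close>

lemma bounded_family_convergent_subseq:
  fixes x :: "'i \<Rightarrow> nat \<Rightarrow> 'a :: heine_borel"
  assumes "finite I" "\<And>i. i \<in> I \<Longrightarrow> bounded (range (x i))"
  shows "\<exists>r. strict_mono r \<and> (\<forall>i\<in>I. convergent (\<lambda>n. x i (r n)))"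
  using assms
proof (induction I rule: finite_induct)
  case empty
  show ?case by (auto intro!: exI[of _ id] simp: strict_mono_id)
next
  case (insert j I)
  then obtain r where r: "strict_mono r" "\<And>i. i \<in> I \<Longrightarrow> convergent (\<lambda>n. x i (r n))" by auto
  have "bounded (range (\<lambda>n. x j (r n)))"
    using insert.prems[of j] by (rule bounded_subset) auto
  then obtain l s where s: "strict_mono s" "((\<lambda>n. x j (r n)) \<circ> s) \<longlonglongrightarrow> l"
    using bounded_imp_convergent_subsequence by blast
  have "convergent (\<lambda>n. x i ((r \<circ> s) n))" if "i \<in> insert j I" for i
  proof (cases "i = j")
    case True
    then show ?thesis using s(2) by (auto simp: convergent_def o_def)
  next
    case False
    then have "convergent (\<lambda>n. x i (r n))" using that r by auto
    then show ?thesis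
      using convergent_subseq_convergent[of "\<lambda>n. x i (r n)" s] s(1) by (simp add: o_def)
  qed
  then show ?case using strict_mono_o[OF r(1) s(1)] by (intro exI[of _ "r \<circ> s"]) blast
qed

text \<open>Vectors in the range of \<open>K\<close> are determined by finitely many coordinates
  with respect to \<open>b\<close>; along a bounded sequence these are bounded complex numbers, so
  they converge simultaneously on a subsequence.\<close>

lemma finite_rank_convergent_subseq:
  fixes F :: "nat \<Rightarrow> L2"
  assumes K: "bounded_operator K" and b: "orthonormal b" "range K \<subseteq> L2.span b"
    and F: "\<And>n. norm (F n) \<le> 1"
  obtains r y where "strict_mono r" "(\<lambda>n. K (F (r n))) \<longlonglongrightarrow> y"
proof -
  obtain C where C: "C > 0" "\<And>f. norm (K f) \<le> C * norm f" using bounded_operatorE[OF K] by blast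
  have fin: "finite b" using b by (simp add: orthonormal_def)
  have "bounded (range (\<lambda>n. cinner (K (F n)) e))" for e
  proof (rule boundedI)
    fix z assume "z \<in> range (\<lambda>n. cinner (K (F n)) e)"
    then obtain n where z: "z = cinner (K (F n)) e" by auto
    have "C * norm (F n) \<le> C * 1" by (intro mult_left_mono F) (use C in simp)
    then have "norm (K (F n)) \<le> C" using C(2)[of "F n"] by linarith
    then show "norm z \<le> C * norm e"
      unfolding z by (intro order_trans[OF cmod_cinner_le] mult_right_mono) auto
  qed
  then obtain r where r: "strict_mono r" "\<forall>e\<in>b. convergent (\<lambda>n. cinner (K (F (r n))) e)"
    using bounded_family_convergent_subseq[OF fin, of "\<lambda>e n. cinner (K (F n)) e"] by blast
  then obtain l where l: "\<And>e. e \<in> b \<Longrightarrow> (\<lambda>n. cinner (K (F (r n))) e) \<longlonglongrightarrow> l e"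
    unfolding convergent_def by metis
  have "(\<lambda>n. \<Sum>e\<in>b. cinner (K (F (r n))) e *\<^sub>C e) \<longlonglongrightarrow> (\<Sum>e\<in>b. l e *\<^sub>C e)"
  proof (rule tendsto_sum)
    fix e assume e: "e \<in> b"
    have "(\<lambda>n. cmod (cinner (K (F (r n))) e - l e) * norm e) \<longlonglongrightarrow> 0"
      by (intro tendsto_mult_left_zero tendsto_norm_zero LIM_zero l e)
    then have "(\<lambda>n. norm (cinner (K (F (r n))) e *\<^sub>C e - l e *\<^sub>C e)) \<longlonglongrightarrow> 0"
      by (simp only: L2.scale_left_diff_distrib[symmetric] norm_scaleC)
    then have "(\<lambda>n. cinner (K (F (r n))) e *\<^sub>C e - l e *\<^sub>C e) \<longlonglongrightarrow> 0"
      by (rule tendsto_norm_zero_cancel)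
    then show "(\<lambda>n. cinner (K (F (r n))) e *\<^sub>C e) \<longlonglongrightarrow> l e *\<^sub>C e"
      by (rule LIM_zero_cancel)
  qed
  moreover have "(\<Sum>e\<in>b. cinner (K f) e *\<^sub>C e) = K f" for f
    using proj_span[OF b(1), of "K f"] b(2) by (auto simp: proj_def)
  ultimately show ?thesis using that r(1) by simp
qed

text \<open>Nonnegativity is tested on \<open>f - t T f\<close> with \<open>t = 1 / D\<close>, which
  lies in \<open>W\<close> because \<open>W\<close> is invariant. The quadratic term is then at most
  half of the linear one in absolute value. This turns small values of the form of \<open>T\<close>
  into small \<open>T f\<close>.\<close>

lemma nonneg_form_norm_le:
  assumes W: "\<And>f g c. f \<in> W \<Longrightarrow> g \<in> W \<Longrightarrow> f - c *\<^sub>R g \<in> W" "\<And>f. f \<in> W \<Longrightarrow> T f \<in> W"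
    and T: "self_adjoint T" "\<And>f. f \<in> W \<Longrightarrow> 0 \<le> inner (T f) f"
    and D: "D > 0" "\<And>f. norm (T f) \<le> D * norm f" and f: "f \<in> W"
  shows "(norm (T f))\<^sup>2 \<le> D * inner (T f) f"
proof -
  have lin: "clinear_op T" using T(1) by (simp add: self_adjoint_def bounded_operator_clinear)
  define t where "t = 1 / D"
  have "f - t *\<^sub>R T f \<in> W" using W f by blast
  then have "0 \<le> inner (T (f - t *\<^sub>R T f)) (f - t *\<^sub>R T f)" by (rule T(2))
  also have "T (f - t *\<^sub>R T f) = T f - t *\<^sub>R T (T f)"
    by (simp add: scaleR_eq_scaleC clinear_op_diff[OF lin] clinear_op_scaleC[OF lin])
  also have "inner (T f - t *\<^sub>R T (T f)) (f - t *\<^sub>R T f)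
    = inner (T f) f - 2 * t * (norm (T f))\<^sup>2 + t\<^sup>2 * inner (T (T f)) (T f)"
    using self_adjoint_inner[OF T(1), of "T f" f] unfolding power2_norm_eq_inner
    by (simp add: inner_diff_left inner_diff_right power2_eq_square algebra_simps)
  also have "inner (T (T f)) (T f) \<le> D * (norm (T f))\<^sup>2"
    using norm_cauchy_schwarz[of "T (T f)" "T f"] mult_right_mono[OF D(2)[of "T f"], of "norm (T f)"]
    by (simp add: power2_eq_square mult.assoc)
  then have "t\<^sup>2 * inner (T (T f)) (T f) \<le> t\<^sup>2 * (D * (norm (T f))\<^sup>2)" by (intro mult_left_mono) auto
  then have "inner (T f) f - 2 * t * (norm (T f))\<^sup>2 + t\<^sup>2 * inner (T (T f)) (T f)
    \<le> inner (T f) f - t * (norm (T f))\<^sup>2"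
    using D(1) by (simp add: t_def power2_eq_square)
  finally show ?thesis using D(1) by (simp add: t_def field_simps)
qed

text \<open>Minimise the form of \<open>A\<close> over the unit vectors orthogonal to
  \<open>S\<close>. The infimum \<open>m\<close> is negative because of \<open>f0\<close>, and
  \<open>T = A - m\<close> has a nonnegative form on the complement, so a minimising sequence
  satisfies \<open>T (F n) --> 0\<close>. Any norm limit of a subsequence is then the required
  eigenvector.\<close>

lemma negative_eigenvector:
  assumes B: "self_adjoint B" "\<And>f. 0 \<le> inner (B f) f"
    and K: "self_adjoint K" and b: "orthonormal b" "range K \<subseteq> L2.span b"
    and A: "\<And>f. A f = B f + K f"
    and S: "\<And>e. e \<in> S \<Longrightarrow> \<exists>l. A e = complex_of_real l *\<^sub>C e"
    and f0: "\<And>e. e \<in> S \<Longrightarrow> cinner f0 e = 0" "inner (A f0) f0 < 0"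
  obtains f m where "m < 0" "f \<noteq> 0" "A f = complex_of_real m *\<^sub>C f" "\<And>e. e \<in> S \<Longrightarrow> cinner f e = 0"
proof -
  have "A = (\<lambda>f. B f + K f)" using A by auto
  then have saA: "self_adjoint A" using self_adjoint_plus[OF B(1) K] by simp
  then have bA: "bounded_operator A" by (simp add: self_adjoint_def)
  then have linA: "clinear_op A" by (rule bounded_operator_clinear)
  \<comment> \<open>\<open>S\<close> consists of eigenvectors with real eigenvalues and
    \<open>A\<close> is self-adjoint, so the orthogonal complement \<open>W\<close> is invariant
    under \<open>A\<close>.\<close>
  define W where "W = {f. \<forall>e\<in>S. cinner f e = 0}"
  have WA: "A f \<in> W" if "f \<in> W" for f
  proof -
    have "cinner (A f) e = 0" if e: "e \<in> S" for e
    proof -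
      obtain l where "A e = complex_of_real l *\<^sub>C e" using S[OF e] by auto
      then have "cinner f (A e) = 0" using \<open>f \<in> W\<close> e by (simp add: W_def cinner_simps)
      then show ?thesis using saA by (simp add: self_adjoint_def)
    qed
    then show ?thesis by (simp add: W_def)
  qed
  have Wlin: "f - c *\<^sub>R g \<in> W" if "f \<in> W" "g \<in> W" for f g c
    using that by (simp add: W_def scaleR_eq_scaleC cinner_simps)
  have Wscale: "c *\<^sub>R f \<in> W" if "f \<in> W" for f c
    using that by (simp add: W_def scaleR_eq_scaleC cinner_simps)
  have Ascale: "inner (A (c *\<^sub>R f)) (c *\<^sub>R f) = c\<^sup>2 * inner (A f) f" for f c
    unfolding scaleR_eq_scaleC[of c f] clinear_op_scaleC[OF linA]
    by (simp add: scaleR_eq_scaleC[symmetric] power2_eq_square)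
  obtain C where C: "C > 0" "\<And>f. norm (A f) \<le> C * norm f" using bounded_operatorE[OF bA] by blast
  define J where "J = (\<lambda>f. inner (A f) f) ` {f \<in> W. norm f = 1}"
  define m where "m = Inf J"
  have low: "- C \<le> inner (A f) f" if "norm f = 1" for f
    using Cauchy_Schwarz_ineq2[of "A f" f] C(2)[of f] that by (simp add: abs_le_iff)
  have bdd: "bdd_below J" by (rule bdd_belowI[of _ "- C"]) (auto simp: J_def low)
  have unit: "inner (A f) f / (norm f)\<^sup>2 \<in> J" if "f \<in> W" "f \<noteq> 0" for f
  proof -
    have "(1 / norm f) *\<^sub>R f \<in> {f \<in> W. norm f = 1}" using that Wscale by simp
    then have "inner (A ((1 / norm f) *\<^sub>R f)) ((1 / norm f) *\<^sub>R f) \<in> J" unfolding J_def by (rule imageI)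
    then show ?thesis unfolding Ascale by (simp add: power_divide)
  qed
  have f0': "f0 \<in> W" "f0 \<noteq> 0" using f0 by (auto simp: W_def)
  have m_le: "m * (norm f)\<^sup>2 \<le> inner (A f) f" if "f \<in> W" for f
  proof (cases "f = 0")
    case False
    then have "m \<le> inner (A f) f / (norm f)\<^sup>2"
      unfolding m_def using cInf_lower[OF unit bdd] that by simp
    then show ?thesis using False by (simp add: field_simps)
  qed simp
  have m: "m < 0"
    using cInf_lower[OF unit[OF f0'] bdd] f0(2) f0'(2) unfolding m_def
    by (smt (verit) divide_neg_pos zero_less_norm_iff zero_less_power)
  define T where "T f = A f - complex_of_real m *\<^sub>C f" for f
  have saT: "self_adjoint T"
    unfolding T_def by (intro self_adjoint_minus saA self_adjoint_scaleR self_adjoint_id)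
  have bT: "bounded_operator T" using saT by (simp add: self_adjoint_def)
  obtain D where D: "D > 0" "\<And>f. norm (T f) \<le> D * norm f" using bounded_operatorE[OF bT] by blast
  have Tpos: "0 \<le> inner (T f) f" if "f \<in> W" for f
    using m_le[OF that] by (simp add: T_def inner_diff_left scaleR_eq_scaleC[symmetric] power2_norm_eq_inner)
  have TW: "T f \<in> W" if "f \<in> W" for f
    unfolding T_def scaleR_eq_scaleC[symmetric] using WA Wlin that by blast
  have "\<exists>f\<in>W. norm f = 1 \<and> inner (A f) f < m + 1 / real (Suc n)" for n
  proof -
    have "J \<noteq> {}" using unit[OF f0'] by blast
    then have "\<exists>y\<in>J. y < m + 1 / real (Suc n)"
      using cInf_lessD[of J "m + 1 / real (Suc n)"] by (auto simp: m_def)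
    then show ?thesis by (auto simp: J_def)
  qed
  then obtain F where F: "\<And>n. F n \<in> W" "\<And>n. norm (F n) = 1"
    "\<And>n. inner (A (F n)) (F n) < m + 1 / real (Suc n)" by metis
  have TF_le: "(norm (T (F n)))\<^sup>2 \<le> D * (1 / real (Suc n))" for n
  proof -
    have "inner (T (F n)) (F n) \<le> 1 / real (Suc n)"
      using F(2,3)[of n]
      by (simp add: T_def inner_diff_left scaleR_eq_scaleC[symmetric] power2_norm_eq_inner[symmetric])
    then show ?thesis
      using nonneg_form_norm_le[of W T D "F n", OF Wlin TW saT Tpos D F(1)] D(1)
      by (meson less_imp_le mult_left_mono order_trans)
  qed
  have "(\<lambda>n. D * (1 / real (Suc n))) \<longlonglongrightarrow> D * 0"
    by (intro tendsto_mult tendsto_const LIMSEQ_Suc[OF lim_1_over_n])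
  then have "(\<lambda>n. D * (1 / real (Suc n))) \<longlonglongrightarrow> 0" by simp
  then have "(\<lambda>n. (norm (T (F n)))\<^sup>2) \<longlonglongrightarrow> 0"
    by (rule Lim_null_comparison[rotated]) (use TF_le in auto)
  then have "(\<lambda>n. sqrt ((norm (T (F n)))\<^sup>2)) \<longlonglongrightarrow> sqrt 0" by (rule tendsto_real_sqrt)
  then have TF: "(\<lambda>n. T (F n)) \<longlonglongrightarrow> 0" by (simp add: tendsto_norm_zero_iff)
  have bK: "bounded_operator K" and bB: "bounded_operator B" using K B by (auto simp: self_adjoint_def)
  obtain r y where r: "strict_mono r" and y: "(\<lambda>n. K (F (r n))) \<longlonglongrightarrow> y"
    using finite_rank_convergent_subseq[OF bK b, of F] F(2) by auto
  obtain R where R: "bounded_operator R" "\<And>f. R (B f - complex_of_real m *\<^sub>C f) = f"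
    using shifted_nonneg_inverse[OF bB B(2) m] by blast
  have TFr: "(\<lambda>n. T (F (r n))) \<longlonglongrightarrow> 0"
    using LIMSEQ_subseq_LIMSEQ[OF TF r] by (simp add: o_def)
  \<comment> \<open>Norm convergence comes from \<open>(B - m) F = T F - K F\<close>: the right side
    converges along \<open>r\<close>, and the bounded resolvent \<open>R\<close> of \<open>B\<close>
    at \<open>m\<close> carries this over to \<open>F\<close> itself.\<close>
  have "(\<lambda>n. R (T (F (r n)) - K (F (r n)))) \<longlonglongrightarrow> R (0 - y)"
    by (intro tendsto_bounded_operator[OF R(1)] tendsto_diff TFr y)
  moreover have "T (F (r n)) - K (F (r n)) = B (F (r n)) - complex_of_real m *\<^sub>C F (r n)" for n
    by (simp add: T_def A)
  ultimately obtain f where f: "(\<lambda>n. F (r n)) \<longlonglongrightarrow> f" using R(2) by auto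
  have "(\<lambda>n. T (F (r n))) \<longlonglongrightarrow> T f" by (rule tendsto_bounded_operator[OF bT f])
  then have "T f = 0" using TFr LIMSEQ_unique by blast
  then have eig: "A f = complex_of_real m *\<^sub>C f" by (simp add: T_def)
  have "(\<lambda>n. norm (F (r n))) \<longlonglongrightarrow> norm f" by (intro tendsto_norm f)
  then have "norm f = 1" using F(2) by (simp add: LIMSEQ_const_iff)
  then have nz: "f \<noteq> 0" by auto
  have orth: "cinner f e = 0" if "e \<in> S" for e
  proof -
    have "(\<lambda>n. cinner (F (r n)) e) \<longlonglongrightarrow> cinner f e" by (rule tendsto_cinner_left[OF f])
    then show ?thesis using F(1) that by (simp add: W_def LIMSEQ_const_iff)
  qed
  show ?thesis using m nz eig orth by (rule that)
qed

section \<open>Complete systems of negative eigenvectors\<close>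

text \<open>Values of \<open>l\<close> may repeat, so \<open>card S\<close> counts eigenvalues with
  multiplicity. The last clause is what excludes any further negative spectrum.\<close>

definition negative_eigenbasis :: "(L2 \<Rightarrow> L2) \<Rightarrow> L2 set \<Rightarrow> (L2 \<Rightarrow> real) \<Rightarrow> bool" where
  "negative_eigenbasis A S l \<longleftrightarrow> orthonormal S \<and>
     (\<forall>e\<in>S. l e < 0 \<and> A e = complex_of_real (l e) *\<^sub>C e) \<and>
     (\<forall>f. (\<forall>e\<in>S. cinner f e = 0) \<longrightarrow> 0 \<le> inner (A f) f)"

lemma eigenvector_sum:
  assumes S: "orthonormal S" and A: "clinear_op A" and e: "\<And>e. e \<in> S \<Longrightarrow> A e = complex_of_real (l e) *\<^sub>C e"
  shows "inner (A (\<Sum>e\<in>S. c e *\<^sub>C e)) (\<Sum>e\<in>S. c e *\<^sub>C e) = (\<Sum>e\<in>S. l e * (cmod (c e))\<^sup>2)"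
proof -
  have "A (\<Sum>e\<in>S. c e *\<^sub>C e) = (\<Sum>e\<in>S. (c e * complex_of_real (l e)) *\<^sub>C e)"
    by (simp add: clinear_op_sum[OF A] clinear_op_scaleC[OF A] e)
  then have "cinner (A (\<Sum>e\<in>S. c e *\<^sub>C e)) (\<Sum>e\<in>S. c e *\<^sub>C e)
    = (\<Sum>e\<in>S. cnj (c e) * (c e * complex_of_real (l e)))"
    by (simp add: cinner_sum_right cinner_scaleC_right cinner_orthonormal_sum[OF S])
  also have "\<dots> = (\<Sum>e\<in>S. complex_of_real (l e * (cmod (c e))\<^sup>2))"
    by (intro sum.cong refl) (simp only: of_real_mult complex_norm_square mult_ac)
  also have "\<dots> = complex_of_real (\<Sum>e\<in>S. l e * (cmod (c e))\<^sup>2)" by simp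
  finally show ?thesis unfolding inner_L2_def by (simp only: Re_complex_of_real)
qed

lemma eigenvector_sum_neg:
  assumes S: "orthonormal S" and A: "clinear_op A"
    and e: "\<And>e. e \<in> S \<Longrightarrow> l e < 0 \<and> A e = complex_of_real (l e) *\<^sub>C e"
    and c: "\<exists>e\<in>S. c e \<noteq> 0"
  shows "inner (A (\<Sum>e\<in>S. c e *\<^sub>C e)) (\<Sum>e\<in>S. c e *\<^sub>C e) < 0"
proof -
  obtain u where u: "u \<in> S" "c u \<noteq> 0" using c by blast
  have "(\<Sum>e\<in>S. l e * (cmod (c e))\<^sup>2) < (\<Sum>e\<in>S. 0)"
    by (rule sum_strict_mono_ex1)
      (use e u S in \<open>auto simp: orthonormal_def mult_nonpos_nonneg less_imp_le mult_neg_pos intro!: bexI[of _ u]\<close>)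
  then show ?thesis by (subst eigenvector_sum[OF S A, of l]) (use e in auto)
qed

text \<open>Take an orthonormal system of negative eigenvectors of maximal size. Sizes are bounded
  by \<open>card b\<close>: a larger system would have a nontrivial combination in the kernel of
  \<open>K\<close>, where the form of \<open>A\<close> is that of \<open>B\<close>, although it is
  negative on the span of the system. If the form were negative somewhere on the complement of a
  maximal system, \<open>negative_eigenvector\<close> would enlarge it.\<close>

lemma negative_eigenbasis_exists:
  assumes B: "self_adjoint B" "\<And>f. 0 \<le> inner (B f) f"
    and K: "self_adjoint K" and b: "orthonormal b" "range K \<subseteq> L2.span b"
    and A: "\<And>f. A f = B f + K f"
  obtains S l where "negative_eigenbasis A S l"
proof -
  have linB: "clinear_op B" and linK: "clinear_op K"
    using B K by (auto simp: self_adjoint_def bounded_operator_clinear)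
  have linA: "clinear_op A" using clinear_op_plus[OF linB linK] A by (simp add: clinear_op_def)
  define P where "P S \<longleftrightarrow> orthonormal S \<and> (\<forall>e\<in>S. \<exists>l<0. A e = complex_of_real l *\<^sub>C e)" for S
  have pick: "\<exists>l. \<forall>e\<in>S. l e < 0 \<and> A e = complex_of_real (l e) *\<^sub>C e" if "P S" for S
    using that unfolding P_def by (intro bchoice) blast
  have fin: "finite b" using b by (simp add: orthonormal_def)
  have card: "card S \<le> card b" if "P S" for S
  proof (rule ccontr)
    assume "\<not> ?thesis"
    have S: "orthonormal S" "finite S" using that by (auto simp: P_def orthonormal_def)
    obtain l where l: "\<And>e. e \<in> S \<Longrightarrow> l e < 0 \<and> A e = complex_of_real (l e) *\<^sub>C e"
      using pick[OF \<open>P S\<close>] by blast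
    obtain c where c: "\<exists>e\<in>S. c e \<noteq> 0" "(\<Sum>e\<in>S. c e *\<^sub>C K e) = 0"
      using dependent_family[OF S(2) fin, of K] \<open>\<not> card S \<le> card b\<close> b(2) by (metis image_subset_iff not_le rangeI subset_iff)
    define f where "f = (\<Sum>e\<in>S. c e *\<^sub>C e)"
    have "K f = 0" using c(2) by (simp add: f_def clinear_op_sum[OF linK] clinear_op_scaleC[OF linK])
    then have "inner (A f) f \<ge> 0" using B(2) A by simp
    moreover have "inner (A f) f < 0"
      unfolding f_def using S(1) linA l c(1) by (rule eigenvector_sum_neg)
    ultimately show False by simp
  qed
  have "P {}" by (simp add: P_def orthonormal_def)
  then have "\<exists>S. P S \<and> (\<forall>S'. P S' \<longrightarrow> card S' \<le> card S)"
    by (rule ex_has_greatest_nat[where b = "Suc (card b)"]) (simp add: card less_Suc_eq_le)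
  then obtain S where S: "P S" "\<And>S'. P S' \<Longrightarrow> card S' \<le> card S" by blast
  have S': "orthonormal S" "finite S" using S(1) by (auto simp: P_def orthonormal_def)
  obtain l where l: "\<And>e. e \<in> S \<Longrightarrow> l e < 0 \<and> A e = complex_of_real (l e) *\<^sub>C e"
    using pick[OF S(1)] by blast
  have "0 \<le> inner (A f) f" if f: "\<forall>e\<in>S. cinner f e = 0" for f
  proof (rule ccontr)
    assume "\<not> ?thesis"
    then have neg: "inner (A f) f < 0" by simp
    obtain g m where g: "m < 0" "g \<noteq> 0" "A g = complex_of_real m *\<^sub>C g" "\<And>e. e \<in> S \<Longrightarrow> cinner g e = 0"
      using negative_eigenvector[OF B K b A, of S f] l f neg by metis
    define u where "u = complex_of_real (1 / norm g) *\<^sub>C g"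
    have u: "orthonormal (insert u S)" "u \<notin> S"
      using orthonormal_insert[OF S'(1) g(2,4)] by (auto simp: u_def)
    have "A u = complex_of_real m *\<^sub>C u"
      by (simp add: u_def clinear_op_scaleC[OF linA] g(3) mult.commute)
    then have "P (insert u S)" using u(1) g(1) S(1) by (auto simp: P_def)
    then have "card (insert u S) \<le> card S" by (rule S(2))
    then show False using u(2) S'(2) by simp
  qed
  then have "negative_eigenbasis A S l" using S'(1) l by (auto simp: negative_eigenbasis_def)
  then show ?thesis by (rule that)
qed

section \<open>The negative spectrum determined by such a system\<close>

context
  fixes A S l
  assumes sa: "self_adjoint A" and basis: "negative_eigenbasis A S l"
begin

text \<open>An eigenvector for \<open>x\<close> is orthogonal to all vectors of \<open>S\<close>
  with a different eigenvalue. Removing its projection onto those with eigenvalue \<open>x\<close>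
  leaves an eigenvector \<open>g\<close> orthogonal to \<open>S\<close>, where the form is
  nonnegative, while its value there is \<open>x * |g|^2\<close>; since \<open>x < 0\<close>, this
  forces \<open>g = 0\<close>.\<close>

lemma eigenspace_eq_span:
  assumes x: "x < 0"
  shows "{f. A f = complex_of_real x *\<^sub>C f} = L2.span {e\<in>S. l e = x}"
proof -
  define T where "T = {e\<in>S. l e = x}"
  have S: "orthonormal S" "\<And>e. e \<in> S \<Longrightarrow> A e = complex_of_real (l e) *\<^sub>C e"
    "\<And>f. (\<And>e. e \<in> S \<Longrightarrow> cinner f e = 0) \<Longrightarrow> 0 \<le> inner (A f) f"
    using basis by (auto simp: negative_eigenbasis_def)
  have T: "orthonormal T" by (rule orthonormal_mono[OF S(1)]) (auto simp: T_def)
  have lin: "clinear_op A" using sa by (simp add: self_adjoint_def bounded_operator_clinear)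
  have sub: "L2.span T \<subseteq> {f. A f = complex_of_real x *\<^sub>C f}"
  proof (rule L2.span_minimal)
    show "T \<subseteq> {f. A f = complex_of_real x *\<^sub>C f}" using S(2) by (auto simp: T_def)
    show "L2.subspace {f. A f = complex_of_real x *\<^sub>C f}"
      by (auto simp: L2.subspace_def clinear_op_0[OF lin] clinear_op_add[OF lin] clinear_op_scaleC[OF lin]
          L2.scale_right_distrib mult.commute)
  qed
  moreover have "f \<in> L2.span T" if f: "A f = complex_of_real x *\<^sub>C f" for f
  proof -
    define g where "g = f - proj T f"
    have orth: "cinner f e = 0" if "e \<in> S" "e \<notin> T" for e
    proof -
      have "cinner (A f) e = cinner f (A e)" using sa by (simp add: self_adjoint_def)
      then have "(complex_of_real x - complex_of_real (l e)) * cinner f e = 0"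
        using that S(2)[of e] by (simp add: f cinner_simps algebra_simps)
      then show ?thesis using that by (auto simp: T_def)
    qed
    have "cinner (proj T f) e = 0" if "e \<in> S" "e \<notin> T" for e
    proof -
      have "cinner u e = 0" if "u \<in> T" for u
        using S(1) that \<open>e \<in> S\<close> \<open>e \<notin> T\<close> by (auto simp: orthonormal_def T_def)
      then show ?thesis by (simp add: proj_def cinner_sum_left cinner_simps)
    qed
    then have "cinner g e = 0" if "e \<in> S" for e
      using orth cinner_proj[OF T] that by (cases "e \<in> T") (auto simp: g_def cinner_simps)
    then have "0 \<le> inner (A g) g" by (rule S(3))
    also have "A g = complex_of_real x *\<^sub>C g"
      using sub proj_in_span[of T f] f
      by (auto simp: g_def clinear_op_diff[OF lin] L2.scale_right_diff_distrib)
    also have "inner \<dots> g = x * (norm g)\<^sup>2" by (simp add: scaleR_eq_scaleC[symmetric] power2_norm_eq_inner)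
    finally have "g = 0" using x by (simp add: zero_le_mult_iff)
    then have "f = proj T f" by (simp add: g_def)
    then show ?thesis using proj_in_span[of T f] by simp
  qed
  ultimately show ?thesis by (auto simp: T_def)
qed

text \<open>Cutting off the negative eigenvectors leaves the nonnegative operator
  \<open>A' = A (1 - proj S)\<close>, whose resolvent \<open>R\<close> at \<open>x\<close> exists. A
  finite-rank correction on the span of \<open>S\<close> turns \<open>R\<close> into the resolvent
  of \<open>A\<close>.\<close>

lemma not_in_spectrum:
  assumes x: "x < 0" "x \<notin> l ` S"
  shows "complex_of_real x \<notin> spectrum A"
proof -
  have S: "orthonormal S" "\<And>e. e \<in> S \<Longrightarrow> A e = complex_of_real (l e) *\<^sub>C e"
    "\<And>f. (\<And>e. e \<in> S \<Longrightarrow> cinner f e = 0) \<Longrightarrow> 0 \<le> inner (A f) f"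
    using basis by (auto simp: negative_eigenbasis_def)
  have fin: "finite S" using S(1) by (simp add: orthonormal_def)
  have bA: "bounded_operator A" using sa by (simp add: self_adjoint_def)
  then have lin: "clinear_op A" by (rule bounded_operator_clinear)
  define A' where "A' f = A f - (\<Sum>e\<in>S. (complex_of_real (l e) * cinner f e) *\<^sub>C e)" for f
  have bA': "bounded_operator A'"
    unfolding A'_def by (intro bounded_operator_minus bounded_operator_sum bounded_operator_rank_one bA fin)
  then have lin': "clinear_op A'" by (rule bounded_operator_clinear)
  have A'_alt: "A' f = A (f - proj S f)" for f
    by (simp add: A'_def proj_def clinear_op_diff[OF lin] clinear_op_sum[OF lin] clinear_op_scaleC[OF lin] S(2) mult.commute)
  have perp: "cinner (f - proj S f) e = 0" if "e \<in> S" for f e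
    using cinner_proj[OF S(1) that] by (simp add: cinner_simps)
  have A'e: "cinner (A' f) e = 0" if e: "e \<in> S" for f e
  proof -
    have "cinner (A' f) e = cinner (f - proj S f) (A e)"
      unfolding A'_alt using sa by (simp add: self_adjoint_def)
    then show ?thesis using perp[OF e] S(2)[OF e] by (simp add: cinner_simps)
  qed
  have "0 \<le> inner (A' f) f" for f
  proof -
    have "cinner (A' f) f = cinner (A' f) (f - proj S f) + cinner (A' f) (proj S f)" by (simp add: cinner_simps)
    also have "cinner (A' f) (proj S f) = 0"
      unfolding proj_def by (simp add: cinner_sum_right cinner_simps A'e)
    finally have "inner (A' f) f = inner (A (f - proj S f)) (f - proj S f)"
      by (simp add: inner_L2_def A'_alt)
    then show ?thesis using S(3) perp by metis
  qed
  then obtain R where R: "bounded_operator R" "\<And>f. A' (R f) - complex_of_real x *\<^sub>C R f = f"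
    using shifted_nonneg_inverse[OF bA' _ x(1)] by metis
  have Re: "cinner (R g) e = - cinner g e / complex_of_real x" if e: "e \<in> S" for g e
  proof -
    have "cinner g e = cinner (A' (R g) - complex_of_real x *\<^sub>C R g) e" using R(2) by simp
    also have "\<dots> = - complex_of_real x * cinner (R g) e" using A'e[OF e] by (simp add: cinner_simps)
    finally show ?thesis using x by (simp add: field_simps)
  qed
  \<comment> \<open>On \<open>e\<close> the operator \<open>R\<close> acts as
    \<open>- 1 / x\<close>, since \<open>A' e = 0\<close>, whereas the resolvent of \<open>A\<close>
    must act as \<open>1 / (l e - x)\<close>; \<open>\<kappa> e\<close> is the difference.\<close>
  define \<kappa> where "\<kappa> e = complex_of_real (1 / (l e - x) + 1 / x)" for e
  have \<kappa>: "\<kappa> e * complex_of_real (l e) - complex_of_real x * \<kappa> e = complex_of_real (l e) / complex_of_real x" if "e \<in> S" for e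
  proof -
    have "l e - x \<noteq> 0" using that x by auto
    have "a * l e - x * a = a * (l e - x)" for a by (simp add: algebra_simps)
    then have "(1 / (l e - x) + 1 / x) * l e - x * (1 / (l e - x) + 1 / x) = (1 / (l e - x) + 1 / x) * (l e - x)" .
    also have "(1 / d + 1 / x) * d = (d + x) / x" if "d \<noteq> 0" for d
      using that x by (simp add: field_simps)
    from this[OF \<open>l e - x \<noteq> 0\<close>] have "(1 / (l e - x) + 1 / x) * (l e - x) = l e / x" by simp
    finally have "(1 / (l e - x) + 1 / x) * l e - x * (1 / (l e - x) + 1 / x) = l e / x" .
    then show ?thesis unfolding \<kappa>_def by (metis of_real_diff of_real_divide of_real_mult)
  qed
  define Q where "Q g = R g + (\<Sum>e\<in>S. (\<kappa> e * cinner g e) *\<^sub>C e)" for g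
  have bQ: "bounded_operator Q"
    unfolding Q_def by (intro bounded_operator_plus bounded_operator_sum bounded_operator_rank_one R fin)
  have AQ: "A (Q g) - complex_of_real x *\<^sub>C Q g = g" for g
  proof -
    have "A (Q g) = A (R g) + (\<Sum>e\<in>S. (\<kappa> e * cinner g e * complex_of_real (l e)) *\<^sub>C e)"
      by (simp add: Q_def clinear_op_add[OF lin] clinear_op_sum[OF lin] clinear_op_scaleC[OF lin] S(2))
    also have "A (R g) = A' (R g) + (\<Sum>e\<in>S. (complex_of_real (l e) * cinner (R g) e) *\<^sub>C e)"
      by (simp add: A'_def)
    also have "A' (R g) = g + complex_of_real x *\<^sub>C R g" using R(2)[of g] by (simp add: algebra_simps)
    finally have "A (Q g) - complex_of_real x *\<^sub>C Q g
      = g + ((\<Sum>e\<in>S. (complex_of_real (l e) * cinner (R g) e) *\<^sub>C e)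
        + (\<Sum>e\<in>S. (\<kappa> e * cinner g e * complex_of_real (l e)) *\<^sub>C e)
        - (\<Sum>e\<in>S. (complex_of_real x * (\<kappa> e * cinner g e)) *\<^sub>C e))"
      by (simp add: Q_def L2.scale_right_distrib L2.scale_sum_right)
    also have "(\<Sum>e\<in>S. (complex_of_real (l e) * cinner (R g) e) *\<^sub>C e)
        + (\<Sum>e\<in>S. (\<kappa> e * cinner g e * complex_of_real (l e)) *\<^sub>C e)
        - (\<Sum>e\<in>S. (complex_of_real x * (\<kappa> e * cinner g e)) *\<^sub>C e)
      = (\<Sum>e\<in>S. (complex_of_real (l e) * cinner (R g) e + \<kappa> e * cinner g e * complex_of_real (l e)
          - complex_of_real x * (\<kappa> e * cinner g e)) *\<^sub>C e)"
      by (simp only: L2.scale_left_distrib L2.scale_left_diff_distrib sum.distrib sum_subtractf)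
    also have "\<dots> = (\<Sum>e\<in>S. 0 *\<^sub>C e)"
    proof (intro sum.cong refl arg_cong2[of _ _ _ _ "(*\<^sub>C)"])
      fix e assume e: "e \<in> S"
      have "complex_of_real (l e) * cinner (R g) e + \<kappa> e * cinner g e * complex_of_real (l e)
          - complex_of_real x * (\<kappa> e * cinner g e)
        = complex_of_real (l e) * cinner (R g) e
          + (\<kappa> e * complex_of_real (l e) - complex_of_real x * \<kappa> e) * cinner g e"
        by (simp add: algebra_simps)
      also have "\<dots> = 0" unfolding \<kappa>[OF e] Re[OF e] by simp
      finally show "complex_of_real (l e) * cinner (R g) e + \<kappa> e * cinner g e * complex_of_real (l e)
          - complex_of_real x * (\<kappa> e * cinner g e) = 0" .
    qed
    finally show ?thesis by simp
  qed
  \<comment> \<open>With injectivity of \<open>A - x\<close> the right inverse \<open>Q\<close> is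
    also a left inverse. The eigenspace for \<open>x\<close> is the span of the empty set because
    \<open>l\<close> omits the value \<open>x\<close>.\<close>
  have inj: "f = 0" if "A f - complex_of_real x *\<^sub>C f = 0" for f
  proof -
    have "f \<in> {f. A f = complex_of_real x *\<^sub>C f}" using that by simp
    also have "\<dots> = L2.span {e\<in>S. l e = x}" by (rule eigenspace_eq_span[OF x(1)])
    also have "{e\<in>S. l e = x} = {}" using x by auto
    finally show ?thesis by simp
  qed
  have "Q (A f - complex_of_real x *\<^sub>C f) = f" for f
  proof -
    define h where "h = Q (A f - complex_of_real x *\<^sub>C f)"
    have "A (h - f) - complex_of_real x *\<^sub>C (h - f) = 0"
      using AQ[of "A f - complex_of_real x *\<^sub>C f"]
      by (simp add: h_def[symmetric] clinear_op_diff[OF lin] L2.scale_right_diff_distrib algebra_simps)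
    from inj[OF this] show ?thesis by (simp add: h_def)
  qed
  then show ?thesis using bQ AQ by (auto simp: spectrum_def)
qed

lemma eigenvalue_in_spectrum:
  assumes "e \<in> S"
  shows "complex_of_real (l e) \<in> spectrum A"
proof -
  have e: "A e = complex_of_real (l e) *\<^sub>C e" "cinner e e = 1"
    using basis assms by (auto simp: negative_eigenbasis_def orthonormal_def)
  have False if "bounded_operator R" "\<And>f. R (A f - complex_of_real (l e) *\<^sub>C f) = f" for R
  proof -
    have "e = R 0" using that(2)[of e] e by simp
    also have "\<dots> = 0" using that(1) by (simp add: bounded_operator_clinear clinear_op_0)
    finally show False using e by simp
  qed
  then show ?thesis by (auto simp: spectrum_def)
qed

text \<open>The negative spectrum is the finite image of \<open>S\<close> under \<open>l\<close>, so
  the sum in \<open>N_minus\<close> applies; the multiplicities are the sizes of the fibres of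
  \<open>l\<close>, which partition \<open>S\<close>.\<close>

lemma N_minus_eq_card: "N_minus A = enat (card S)"
proof -
  have S: "orthonormal S" "\<And>e. e \<in> S \<Longrightarrow> l e < 0" using basis by (auto simp: negative_eigenbasis_def)
  have fin: "finite S" using S(1) by (simp add: orthonormal_def)
  have spec: "negative_spectrum A = l ` S"
    using not_in_spectrum eigenvalue_in_spectrum S(2) by (auto simp: negative_spectrum_def)
  have mult: "multiplicity A x = enat (card {e\<in>S. l e = x})" if "x \<in> l ` S" for x
    unfolding multiplicity_def using that S(2)
    by (subst eigenspace_eq_span) (auto intro!: edim_span_orthonormal orthonormal_mono[OF S(1)])
  have enat_sum: "(\<Sum>x\<in>I. enat (k x)) = enat (\<Sum>x\<in>I. k x)" for I :: "real set" and k
    by (induction I rule: infinite_finite_induct) (auto simp: zero_enat_def)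
  have "N_minus A = (\<Sum>x\<in>l ` S. enat (card {e\<in>S. l e = x}))"
    using fin by (simp add: N_minus_def spec mult)
  also have "\<dots> = enat (\<Sum>x\<in>l ` S. card {e\<in>S. l e = x})" by (rule enat_sum)
  also have "(\<Sum>x\<in>l ` S. card {e\<in>S. l e = x}) = card S"
    using sum.group[OF fin finite_imageI[OF fin, of l] order_refl, of "\<lambda>_. 1 :: nat"] by simp
  finally show ?thesis .
qed

lemma nonneg_operator_iff_empty: "nonneg_operator A \<longleftrightarrow> S = {}"
proof
  assume nn: "nonneg_operator A"
  have False if "e \<in> S" for e
  proof -
    have "inner (A e) e = l e" "l e < 0"
      using basis that by (auto simp: negative_eigenbasis_def orthonormal_def inner_L2_def cinner_simps)
    then show False using nn unfolding nonneg_operator_iff[OF sa] by (metis not_less)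
  qed
  then show "S = {}" by blast
next
  assume "S = {}"
  then show "nonneg_operator A"
    using basis by (simp add: nonneg_operator_iff[OF sa] negative_eigenbasis_def)
qed

end

section \<open>Comparing the two operators\<close>

text \<open>The projection theorem for a subspace \<open>W\<close> that is not assumed closed, such
  as the image of a kernel under \<open>laplace\<close>. The nearest point may lie outside
  \<open>W\<close>, so the residual \<open>w\<close> is characterised by approximation from
  \<open>W\<close>.\<close>

lemma orthogonal_residual:
  fixes v :: L2
  assumes W: "0 \<in> W" "\<And>f g. f \<in> W \<Longrightarrow> g \<in> W \<Longrightarrow> f + g \<in> W" "\<And>c f. f \<in> W \<Longrightarrow> c *\<^sub>C f \<in> W"
  obtains w where "\<And>g. g \<in> W \<Longrightarrow> cinner g w = 0" "\<And>\<epsilon>. \<epsilon> > 0 \<Longrightarrow> \<exists>g\<in>W. norm (v - g - w) < \<epsilon>"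
proof -
  define d where "d = (INF g\<in>W. norm (v - g))"
  have WR: "c *\<^sub>R f \<in> W" if "f \<in> W" for c f using W(3)[OF that] by (simp add: scaleR_eq_scaleC)
  have bdd: "bdd_below ((\<lambda>g. norm (v - g)) ` W)" by (rule bdd_belowI[of _ 0]) auto
  have d_le: "d \<le> norm (v - g)" if "g \<in> W" for g
    unfolding d_def using bdd that by (rule cINF_lower)
  have d0: "0 \<le> d" unfolding d_def using W(1) by (intro cINF_greatest) auto
  have "\<exists>g\<in>W. norm (v - g) < d + 1 / real (Suc n)" for n
  proof -
    have "Inf ((\<lambda>g. norm (v - g)) ` W) < d + 1 / real (Suc n)" by (simp add: d_def)
    then obtain z where "z \<in> (\<lambda>g. norm (v - g)) ` W" "z < d + 1 / real (Suc n)"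
      using cInf_lessD[of "(\<lambda>g. norm (v - g)) ` W"] W(1) by blast
    then show ?thesis by auto
  qed
  then obtain G where G: "\<And>n. G n \<in> W" "\<And>n. norm (v - G n) < d + 1 / real (Suc n)" by metis
  \<comment> \<open>The excess of the squared distance over its minimum. Midpoints of elements of
    \<open>W\<close> lie in \<open>W\<close>, so the parallelogram law bounds
    \<open>|G n - G m|^2\<close> by twice the sum of two excesses.\<close>
  define q where "q n = (d + 1 / real (Suc n))\<^sup>2 - d\<^sup>2" for n
  have par: "(norm (G n - G m))\<^sup>2 \<le> 2 * q n + 2 * q m" for n m
  proof -
    have "(1 / 2) *\<^sub>R (G n + G m) \<in> W" using G(1) W(2) WR by blast
    then have "d\<^sup>2 \<le> (norm (v - (1 / 2) *\<^sub>R (G n + G m)))\<^sup>2"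
      using d0 by (intro power_mono d_le)
    moreover have "(norm (G n - G m))\<^sup>2 = 2 * (norm (v - G n))\<^sup>2 + 2 * (norm (v - G m))\<^sup>2
        - 4 * (norm (v - (1 / 2) *\<^sub>R (G n + G m)))\<^sup>2"
      unfolding power2_norm_eq_inner
      by (simp add: inner_diff_left inner_diff_right inner_add_left inner_add_right
          inner_commute[of "G m" v] inner_commute[of "G n" v] inner_commute[of "G m" "G n"] algebra_simps)
    moreover have "(norm (v - G k))\<^sup>2 \<le> (d + 1 / real (Suc k))\<^sup>2" for k
      using G(2)[of k] by (intro power_mono) auto
    from this[of n] this[of m] have "(norm (v - G n))\<^sup>2 \<le> q n + d\<^sup>2" "(norm (v - G m))\<^sup>2 \<le> q m + d\<^sup>2"
      by (simp_all add: q_def)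
    ultimately show ?thesis by linarith
  qed
  have "q \<longlonglongrightarrow> (d + 0)\<^sup>2 - d\<^sup>2"
    unfolding q_def by (intro tendsto_diff tendsto_power tendsto_add tendsto_const LIMSEQ_Suc[OF lim_1_over_n])
  then have q0: "q \<longlonglongrightarrow> 0" by simp
  have "Cauchy G"
  proof (rule metric_CauchyI)
    fix e :: real assume e: "e > 0"
    then have "\<forall>\<^sub>F n in sequentially. q n < e\<^sup>2 / 4" by (intro order_tendstoD[OF q0]) simp
    then obtain N where N: "\<And>n. n \<ge> N \<Longrightarrow> q n < e\<^sup>2 / 4" by (auto simp: eventually_sequentially)
    have "dist (G m) (G n) < e" if "m \<ge> N" "n \<ge> N" for m n
    proof -
      have "(norm (G m - G n))\<^sup>2 < e\<^sup>2"
        using par[of m n] N[OF that(1)] N[OF that(2)] by linarith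
      then show ?thesis using e by (simp add: dist_norm power_less_imp_less_base)
    qed
    then show "\<exists>M. \<forall>m\<ge>M. \<forall>n\<ge>M. dist (G m) (G n) < e" by blast
  qed
  then have "convergent G" by (rule Cauchy_convergent)
  then obtain g where g: "G \<longlonglongrightarrow> g" by (auto simp: convergent_def)
  define w where "w = v - g"
  have w: "(\<lambda>n. v - G n) \<longlonglongrightarrow> w" unfolding w_def by (intro tendsto_diff tendsto_const g)
  have "norm w \<le> d"
  proof (rule LIMSEQ_le)
    show "(\<lambda>n. norm (v - G n)) \<longlonglongrightarrow> norm w" by (intro tendsto_norm w)
    show "(\<lambda>n. d + 1 / real (Suc n)) \<longlonglongrightarrow> d"
      using tendsto_add[OF tendsto_const[of d] LIMSEQ_Suc[OF lim_1_over_n]] by simp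
    show "\<exists>N. \<forall>n\<ge>N. norm (v - G n) \<le> d + 1 / real (Suc n)" using G(2) less_imp_le by blast
  qed
  moreover have "d \<le> norm (w - h)" if "h \<in> W" for h
  proof (rule LIMSEQ_le_const)
    show "(\<lambda>n. norm ((v - G n) - h)) \<longlonglongrightarrow> norm (w - h)" by (intro tendsto_norm tendsto_diff w tendsto_const)
    show "\<exists>N. \<forall>n\<ge>N. d \<le> norm ((v - G n) - h)"
      using d_le[OF W(2)[OF G(1) that]] by (simp add: diff_diff_eq)
  qed
  ultimately have min: "norm w \<le> norm (w - h)" if "h \<in> W" for h using that by fastforce
  have re: "inner h w = 0" if h: "h \<in> W" for h
  proof (cases "h = 0")
    case False
    \<comment> \<open>The minimiser of \<open>|w - t h|\<close>; the distance cannot drop below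
      \<open>norm w\<close>, which forces the real inner product to vanish.\<close>
    define t where "t = inner h w / (norm h)\<^sup>2"
    have "(norm w)\<^sup>2 \<le> (norm (w - t *\<^sub>R h))\<^sup>2" using min[OF WR[OF h]] by (intro power_mono) auto
    also have "\<dots> = (norm w)\<^sup>2 - 2 * t * inner h w + t\<^sup>2 * (norm h)\<^sup>2"
      unfolding power2_norm_eq_inner
      by (simp add: inner_diff_left inner_diff_right inner_commute[of w h] power2_eq_square algebra_simps)
    also have "\<dots> = (norm w)\<^sup>2 - (inner h w)\<^sup>2 / (norm h)\<^sup>2"
      using False by (simp add: t_def power2_eq_square field_simps)
    finally have "(inner h w)\<^sup>2 / (norm h)\<^sup>2 \<le> 0" by simp
    then show ?thesis using False by (simp add: divide_le_0_iff)
  qed simp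
  \<comment> \<open>Real orthogonality to \<open>h\<close> and to \<open>\<i> *\<^sub>C h\<close>
    kills the real and the imaginary part.\<close>
  have orth: "cinner h w = 0" if h: "h \<in> W" for h
    using re[OF h] re[OF W(3)[OF h, of "\<i>"]] by (simp add: inner_L2_def cinner_simps complex_eq_iff)
  have approx: "\<exists>h\<in>W. norm (v - h - w) < \<epsilon>" if "\<epsilon> > 0" for \<epsilon>
  proof -
    have "\<forall>\<^sub>F n in sequentially. dist (v - G n) w < \<epsilon>" using w that by (rule tendstoD)
    then obtain n where "dist (v - G n) w < \<epsilon>" by (auto simp: eventually_sequentially)
    then show ?thesis using G(1)[of n] by (auto simp: dist_norm)
  qed
  show ?thesis using orth approx by (rule that)
qed

lemma finite_rank_orthonormal_basis:
  assumes V: "clinear_op V" "finite_rank V"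
  obtains b where "orthonormal b" "L2.span b = range V"
proof -
  obtain B where B: "finite B" "range V \<subseteq> L2.span B"
    using V(2) by (auto simp: finite_rank_def edim_def split: if_splits)
  have sub: "L2.subspace (range V)"
    unfolding L2.subspace_def
  proof (intro conjI ballI allI)
    show "0 \<in> range V" using clinear_op_0[OF V(1)] by (intro image_eqI[of _ _ 0]) auto
    show "x + y \<in> range V" if xy: "x \<in> range V" "y \<in> range V" for x y
    proof -
      obtain f g where "x = V f" "y = V g" using xy by blast
      then have "x + y = V (f + g)" by (simp add: clinear_op_add[OF V(1)])
      then show ?thesis by simp
    qed
    show "c *\<^sub>C x \<in> range V" if x: "x \<in> range V" for c x
    proof -
      obtain f where "x = V f" using x by blast
      then have "c *\<^sub>C x = V (c *\<^sub>C f)" by (simp add: clinear_op_scaleC[OF V(1)])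
      then show ?thesis by simp
    qed
  qed
  \<comment> \<open>\<open>B\<close> itself may stick out of the range, so an independent set inside
    the range is taken; it is finite by comparison with \<open>B\<close>.\<close>
  obtain B' where B': "B' \<subseteq> range V" "L2.independent B'" "range V \<subseteq> L2.span B'"
    by (rule L2.maximal_independent_subset)
  have "finite B'" using L2.independent_span_bound[OF B(1) B'(2)] B B'(1) by blast
  then obtain b where b: "orthonormal b" "L2.span b = L2.span B'" by (rule gram_schmidt)
  have "L2.span B' \<subseteq> range V" using B'(1) sub by (rule L2.span_minimal)
  then show ?thesis using that[OF b(1)] b(2) B'(3) by auto
qed

text \<open>The component \<open>r\<close> of \<open>w\<close> orthogonal to the range satisfies
  \<open>|V r|^2 = (r, V (V r)) = 0\<close>, so it lies in the kernel. It is thus orthogonal to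
  \<open>w\<close> and to \<open>proj b w\<close>, hence to itself.\<close>

lemma orthogonal_kernel_in_range:
  assumes V: "self_adjoint V" and b: "orthonormal b" "L2.span b = range V"
    and w: "\<And>g. V g = 0 \<Longrightarrow> cinner g w = 0"
  shows "w \<in> range V"
proof -
  define r where "r = w - proj b w"
  have rb: "cinner r e = 0" if "e \<in> b" for e
    using cinner_proj[OF b(1) that] by (simp add: r_def cinner_simps)
  have rspan: "cinner r h = 0" if h: "h \<in> range V" for h
  proof -
    have "h = proj b h" using proj_span[OF b(1)] b(2) h by simp
    then have "cinner r h = cinner r (\<Sum>e\<in>b. cinner h e *\<^sub>C e)" by (simp add: proj_def)
    also have "\<dots> = 0" by (simp add: cinner_sum_right cinner_simps rb)
    finally show ?thesis .
  qed
  have "cinner (V r) (V r) = cinner r (V (V r))" using V by (simp add: self_adjoint_def)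
  then have "V r = 0" using rspan[of "V (V r)"] by (simp add: cinner_self_eq_0)
  then have "cinner r w = 0" by (rule w)
  moreover have pr: "proj b w \<in> range V" using proj_in_span[of b w] b(2) by simp
  ultimately have "cinner r r = 0" using rspan[OF pr] by (subst (2) r_def) (simp add: cinner_simps)
  then have "w = proj b w" by (simp add: cinner_self_eq_0 r_def)
  then show ?thesis using pr by simp
qed

lemma hankel_range_laplace_dominated:
  assumes h: "hankel_kernel h" and b: "orthonormal b" "L2.span b = range (hankel_operator h)"
    and u: "u \<in> range (hankel_operator h)"
    and dom: "\<And>f. cmod (cinner f u) \<le> C * norm (laplace f)"
  shows "u = 0"
proof -
  have shift: "(lshift ^^ i) u \<in> range (hankel_operator h)" for i
  proof (induction i)
    case (Suc i)
    then obtain f where "(lshift ^^ i) u = hankel_operator h f" by auto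
    then have "(lshift ^^ Suc i) u = hankel_operator h (rshift f)" by (simp add: hankel_operator_rshift[OF h])
    then show ?case by blast
  qed (use u in simp)
  have fin: "finite b" using b(1) by (simp add: orthonormal_def)
  \<comment> \<open>The index set \<open>{..card b}\<close> has \<open>card b + 1\<close> elements,
    one more than the dimension of the span that contains all these shifts.\<close>
  have sub: "(\<lambda>i. (lshift ^^ i) u) ` {..card b} \<subseteq> L2.span b" using shift b(2) by auto
  obtain c where c: "\<exists>i\<in>{..card b}. c i \<noteq> 0" "(\<Sum>i\<le>card b. c i *\<^sub>C (lshift ^^ i) u) = 0"
    by (rule dependent_family[OF _ fin sub]) simp_all
  then obtain k where "k \<le> card b" "c k \<noteq> 0" by auto
  then show ?thesis using c(2) dom by (rule laplace_dominated_eq_0)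
qed

text \<open>The Laplace transforms of \<open>ker V\<close> are dense: a vector \<open>w\<close> orthogonal to them satisfies
  \<open>laplace w \<in> (ker V)\<^sup>\<bottom> = range V\<close>, while \<open>f \<mapsto> (f, laplace w)\<close> is dominated by \<open>norm (laplace f)\<close>.\<close>

lemma hankel_small_laplace:
  assumes h: "hankel_kernel h" and V: "self_adjoint (hankel_operator h)"
    and b: "orthonormal b" "L2.span b = range (hankel_operator h)" and \<epsilon>: "\<epsilon> > 0"
  shows "\<exists>f. hankel_operator h f = hankel_operator h m \<and> norm (laplace f) < \<epsilon>"
proof -
  define V where "V = hankel_operator h"
  have lin: "clinear_op V" using V by (simp add: V_def self_adjoint_def bounded_operator_clinear)
  define W where "W = laplace ` {g. V g = 0}"
  have 0: "0 \<in> W"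
    unfolding W_def using clinear_op_0[OF clinear_op_laplace] clinear_op_0[OF lin] by (intro image_eqI[of _ _ 0]) auto
  have add: "f + g \<in> W" if fg: "f \<in> W" "g \<in> W" for f g
  proof -
    obtain f' g' where "f = laplace f'" "g = laplace g'" "V f' = 0" "V g' = 0" using fg by (auto simp: W_def)
    then have "f + g = laplace (f' + g')" "V (f' + g') = 0"
      by (simp_all add: clinear_op_add[OF clinear_op_laplace] clinear_op_add[OF lin])
    then show ?thesis by (auto simp: W_def)
  qed
  have scale: "c *\<^sub>C f \<in> W" if f: "f \<in> W" for c f
  proof -
    obtain f' where "f = laplace f'" "V f' = 0" using f by (auto simp: W_def)
    then have "c *\<^sub>C f = laplace (c *\<^sub>C f')" "V (c *\<^sub>C f') = 0"
      by (simp_all add: clinear_op_scaleC[OF clinear_op_laplace] clinear_op_scaleC[OF lin])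
    then show ?thesis by (auto simp: W_def)
  qed
  obtain w where w: "\<And>g. g \<in> W \<Longrightarrow> cinner g w = 0"
    "\<And>\<epsilon>. \<epsilon> > 0 \<Longrightarrow> \<exists>g\<in>W. norm (laplace m - g - w) < \<epsilon>"
    using orthogonal_residual[OF 0 add scale, of "laplace m"] by metis
  have "laplace w \<in> range V"
    unfolding V_def
  proof (rule orthogonal_kernel_in_range[OF V b])
    fix g assume "hankel_operator h g = 0"
    then have "laplace g \<in> W" by (auto simp: W_def V_def)
    then show "cinner g (laplace w) = 0" using w(1) by (simp add: cinner_laplace[symmetric])
  qed
  moreover have "cmod (cinner f (laplace w)) \<le> norm w * norm (laplace f)" for f
    using cmod_cinner_le[of "laplace f" w] by (simp add: cinner_laplace mult.commute)
  ultimately have Lw: "laplace w = 0"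
    unfolding V_def by (rule hankel_range_laplace_dominated[OF h b])
  \<comment> \<open>Since \<open>laplace w = 0\<close>, the residual is orthogonal to
    \<open>laplace m\<close> as well as to \<open>W\<close>, yet it is approximated by vectors
    \<open>laplace m - g\<close> with \<open>g\<close> in \<open>W\<close>.\<close>
  have "w = 0"
  proof (rule ccontr)
    assume nz: "w \<noteq> 0"
    then obtain g where g: "g \<in> W" "norm (laplace m - g - w) < norm w" using w(2)[of "norm w"] by auto
    have "cinner (laplace m - g - w) w = - cinner w w"
      using w(1)[OF g(1)] by (simp add: cinner_simps cinner_laplace Lw)
    then have "(norm w)\<^sup>2 \<le> norm (laplace m - g - w) * norm w"
      using cmod_cinner_le[of "laplace m - g - w" w] by (simp add: cinner_self_norm norm_power)
    then show False using g(2) nz by (simp add: power2_eq_square)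
  qed
  then obtain g where "V g = 0" "norm (laplace m - laplace g) < \<epsilon>"
    using w(2)[OF \<epsilon>] by (auto simp: W_def)
  then have "V (m - g) = V m" "norm (laplace (m - g)) < \<epsilon>"
    by (simp_all add: clinear_op_diff[OF clinear_op_laplace] clinear_op_diff[OF lin])
  then show ?thesis unfolding V_def by blast
qed

section \<open>Comparison of the two systems by dimension counts\<close>

lemma inner_carleman: "inner (carleman_operator f) f = (norm (laplace f))\<^sup>2"
  by (simp add: carleman_eq_laplace_laplace self_adjoint_inner[OF self_adjoint_laplace] power2_norm_eq_inner)

lemma self_adjoint_carleman: "self_adjoint carleman_operator"
proof -
  have "carleman_operator = (\<lambda>f. laplace (laplace f))" by (simp add: fun_eq_iff carleman_eq_laplace_laplace)
  moreover have "bounded_operator (\<lambda>f. laplace (laplace f))"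
    unfolding bounded_operator_iff
  proof (rule conjI[OF clinear_op_comp[OF clinear_op_laplace clinear_op_laplace]], intro exI allI)
    fix f
    have "norm (laplace (laplace f)) \<le> Gamma (1 / 2) * norm (laplace f)" by (rule norm_laplace_le)
    also have "\<dots> \<le> Gamma (1 / 2) * (Gamma (1 / 2) * norm f)" by (intro mult_left_mono norm_laplace_le) simp
    finally show "norm (laplace (laplace f)) \<le> (Gamma (1 / 2) * Gamma (1 / 2)) * norm f" by (simp add: mult.assoc)
  qed
  ultimately show ?thesis by (simp add: self_adjoint_def carleman_eq_laplace_laplace cinner_laplace)
qed

text \<open>If \<open>T\<close> were larger than \<open>S\<close>, some nonzero combination of
  \<open>T\<close> would be orthogonal to \<open>S\<close>. There the form of \<open>V\<close>,
  hence also that of \<open>A\<close>, is nonnegative, contradicting negativity on the span of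
  \<open>T\<close>.\<close>

lemma card_negative_eigenbasis_le:
  assumes V: "self_adjoint V" and A: "self_adjoint A"
    and bV: "negative_eigenbasis V S l" and bA: "negative_eigenbasis A T k"
    and A_eq: "\<And>f. A f = carleman_operator f + V f"
  shows "card T \<le> card S"
proof (rule ccontr)
  assume "\<not> ?thesis"
  then have less: "card S < card T" by simp
  have S: "orthonormal S" "finite S" and T: "orthonormal T" "finite T"
    using bV bA by (auto simp: negative_eigenbasis_def orthonormal_def)
  have lin: "clinear_op A" using A by (simp add: self_adjoint_def bounded_operator_clinear)
  have "proj S ` T \<subseteq> L2.span S" using proj_in_span by blast
  then obtain c where c: "\<exists>e\<in>T. c e \<noteq> 0" "(\<Sum>e\<in>T. c e *\<^sub>C proj S e) = 0"
    using dependent_family[OF T(2) S(2) _ less] by metis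
  define f where "f = (\<Sum>e\<in>T. c e *\<^sub>C e)"
  have "cinner f s = cinner (\<Sum>e\<in>T. c e *\<^sub>C proj S e) s" if "s \<in> S" for s
    using that by (simp add: f_def cinner_sum_left cinner_scaleC_left cinner_proj[OF S(1)])
  then have "0 \<le> inner (V f) f" using bV c(2) by (simp add: negative_eigenbasis_def)
  then have "0 \<le> inner (A f) f" by (simp add: A_eq inner_add_left inner_carleman)
  moreover have "k e < 0 \<and> A e = complex_of_real (k e) *\<^sub>C e" if "e \<in> T" for e
    using bA that by (simp add: negative_eigenbasis_def)
  then have "inner (A f) f < 0"
    unfolding f_def using c(1) by (rule eigenvector_sum_neg[OF T(1) lin])
  ultimately show False by simp
qed

text \<open>The same count with each \<open>e\<close> in \<open>S\<close> replaced by a vector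
  \<open>F e\<close> that has the same image under \<open>V\<close> and a small Laplace transform.
  The \<open>F e\<close> need not be orthonormal; all estimates are in terms of the coefficients
  \<open>c\<close>, through \<open>N\<close>.\<close>

lemma card_negative_eigenbasis_ge:
  assumes V: "self_adjoint V" and A: "self_adjoint A"
    and bV: "negative_eigenbasis V S l" and bA: "negative_eigenbasis A T k"
    and A_eq: "\<And>f. A f = carleman_operator f + V f"
    and small: "\<And>m \<epsilon>. \<epsilon> > 0 \<Longrightarrow> \<exists>f. V f = V m \<and> norm (laplace f) < \<epsilon>"
  shows "card S \<le> card T"
proof (rule ccontr)
  assume "\<not> ?thesis"
  then have less: "card T < card S" by simp
  have S: "orthonormal S" "finite S" and T: "orthonormal T" "finite T"
    using bV bA by (auto simp: negative_eigenbasis_def orthonormal_def)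
  have ne: "S \<noteq> {}" using less by auto
  have linV: "clinear_op V" using V by (simp add: self_adjoint_def bounded_operator_clinear)
  have l: "\<And>e. e \<in> S \<Longrightarrow> l e < 0 \<and> V e = complex_of_real (l e) *\<^sub>C e"
    using bV by (simp add: negative_eigenbasis_def)
  \<comment> \<open>The gap between 0 and the negative eigenvalues of \<open>V\<close>, positive
    because \<open>S\<close> is finite and nonempty.\<close>
  define \<delta> where "\<delta> = - Max (l ` S)"
  have \<delta>: "\<delta> > 0" using l ne S(2) by (simp add: \<delta>_def)
  have l_le: "l e \<le> - \<delta>" if "e \<in> S" for e using that S(2) by (simp add: \<delta>_def)
  \<comment> \<open>Chosen so that \<open>\<eta>^2 * card S = \<delta> / 2\<close>. By
    Cauchy-Schwarz over \<open>S\<close> the Carleman form is then at most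
    \<open>\<delta> / 2 * N\<close>, against \<open>- \<delta> * N\<close> from
    \<open>V\<close>.\<close>
  define \<eta> where "\<eta> = sqrt (\<delta> / (2 * card S))"
  have \<eta>: "\<eta> > 0" "\<eta>\<^sup>2 * card S < \<delta>" using \<delta> ne S(2) by (auto simp: \<eta>_def card_gt_0_iff)
  obtain F where F: "\<And>e. V (F e) = V e" "\<And>e. norm (laplace (F e)) < \<eta>" using small[OF \<eta>(1)] by metis
  have "(\<lambda>e. proj T (F e)) ` S \<subseteq> L2.span T" using proj_in_span by blast
  then obtain c where c: "\<exists>e\<in>S. c e \<noteq> 0" "(\<Sum>e\<in>S. c e *\<^sub>C proj T (F e)) = 0"
    using dependent_family[OF S(2) T(2) _ less] by metis
  define f where "f = (\<Sum>e\<in>S. c e *\<^sub>C F e)"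
  define g where "g = (\<Sum>e\<in>S. c e *\<^sub>C e)"
  define N where "N = (\<Sum>e\<in>S. (cmod (c e))\<^sup>2)"
  have "cinner f s = cinner (\<Sum>e\<in>S. c e *\<^sub>C proj T (F e)) s" if "s \<in> T" for s
    using that by (simp add: f_def cinner_sum_left cinner_scaleC_left cinner_proj[OF T(1)])
  then have "0 \<le> inner (A f) f" using bA c(2) by (simp add: negative_eigenbasis_def)
  then have pos: "0 \<le> (norm (laplace f))\<^sup>2 + inner (V f) f" by (simp add: A_eq inner_add_left inner_carleman)
  have Vfg: "V f = V g" by (simp add: f_def g_def clinear_op_sum[OF linV] clinear_op_scaleC[OF linV] F)
  \<comment> \<open>The form of \<open>V\<close> depends on \<open>f\<close> only through
    \<open>V f\<close>, so it can be evaluated at the eigenvector combination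
    \<open>g\<close>.\<close>
  have "inner (V f) f = inner (V g) f" by (simp add: Vfg)
  also have "\<dots> = inner g (V f)" by (rule self_adjoint_inner[OF V])
  also have "\<dots> = inner (V g) g" by (simp add: Vfg inner_commute)
  also have "\<dots> = (\<Sum>e\<in>S. l e * (cmod (c e))\<^sup>2)"
    unfolding g_def by (rule eigenvector_sum[OF S(1) linV]) (use l in auto)
  also have "\<dots> \<le> (\<Sum>e\<in>S. - \<delta> * (cmod (c e))\<^sup>2)" by (intro sum_mono mult_right_mono l_le) auto
  also have "\<dots> = - \<delta> * N" by (simp add: N_def sum_distrib_left)
  finally have neg: "inner (V f) f \<le> - \<delta> * N" .
  have "norm (laplace f) \<le> (\<Sum>e\<in>S. norm (c e *\<^sub>C laplace (F e)))"
    unfolding f_def clinear_op_sum[OF clinear_op_laplace] clinear_op_scaleC[OF clinear_op_laplace] by (rule norm_sum)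
  also have "\<dots> \<le> (\<Sum>e\<in>S. cmod (c e) * \<eta>)"
    unfolding norm_scaleC by (intro sum_mono mult_left_mono less_imp_le[OF F(2)]) auto
  finally have "(norm (laplace f))\<^sup>2 \<le> (\<Sum>e\<in>S. cmod (c e) * \<eta>)\<^sup>2" by (intro power_mono) auto
  also have "\<dots> \<le> (\<Sum>e\<in>S. (cmod (c e))\<^sup>2) * (\<Sum>e\<in>S. \<eta>\<^sup>2)" by (rule Cauchy_Schwarz_ineq_sum)
  also have "\<dots> = (\<eta>\<^sup>2 * card S) * N" by (simp add: N_def)
  finally have "(norm (laplace f))\<^sup>2 \<le> (\<eta>\<^sup>2 * card S) * N" .
  moreover have "(\<eta>\<^sup>2 * card S) * N < \<delta> * N"
  proof (rule mult_strict_right_mono[OF \<eta>(2)])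
    obtain u where u: "u \<in> S" "c u \<noteq> 0" using c(1) by blast
    then show "0 < N" unfolding N_def using S(2) by (intro sum_pos2[of _ u]) auto
  qed
  ultimately show False using pos neg by simp
qed

theorem theorem1p3:
  fixes V H :: "L2 \<Rightarrow> L2"
  assumes "is_hankel_operator V"
    and "self_adjoint V"
    and "finite_rank V"
    and "H = (\<lambda>f. carleman_operator f + V f)"
  shows "N_minus H = N_minus V \<and> (nonneg_operator H \<longleftrightarrow> nonneg_operator V)"
proof -
  obtain h where h: "hankel_kernel h" "V = hankel_operator h"
    using assms(1) by (auto simp: is_hankel_operator_def)
  have lin: "clinear_op V" using assms(2) by (simp add: self_adjoint_def bounded_operator_clinear)
  obtain b where b: "orthonormal b" "L2.span b = range V"
    by (rule finite_rank_orthonormal_basis[OF lin assms(3)])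
  have H: "self_adjoint H" unfolding assms(4) by (intro self_adjoint_plus self_adjoint_carleman assms(2))
  have H_eq: "H f = carleman_operator f + V f" for f by (simp add: assms(4))
  have sub: "range V \<subseteq> L2.span b" using b(2) by simp
  have carleman_pos: "0 \<le> inner (carleman_operator f) f" for f by (simp add: inner_carleman)
  obtain T k where T: "negative_eigenbasis H T k"
    by (rule negative_eigenbasis_exists[OF self_adjoint_carleman carleman_pos assms(2) b(1) sub H_eq])
  \<comment> \<open>\<open>V\<close> itself is treated as a finite-rank perturbation of the zero
    operator, so one existence result covers both \<open>H\<close> and \<open>V\<close>.\<close>
  have zero: "self_adjoint (\<lambda>f. 0)"
    by (auto simp: self_adjoint_def bounded_operator_iff clinear_op_def intro: exI[of _ 0])
  have zero_pos: "0 \<le> inner (0 :: L2) f" and V_eq: "V f = 0 + V f" for f by simp_all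
  obtain S l where S: "negative_eigenbasis V S l"
    by (rule negative_eigenbasis_exists[OF zero zero_pos assms(2) b(1) sub V_eq])
  have small: "\<exists>f. V f = V m \<and> norm (laplace f) < \<epsilon>" if "\<epsilon> > 0" for m \<epsilon>
    using hankel_small_laplace[OF h(1) assms(2)[unfolded h(2)] b[unfolded h(2)] that] unfolding h(2) .
  have card: "card T = card S"
  proof (rule antisym)
    show "card T \<le> card S" using assms(2) H S T H_eq by (rule card_negative_eigenbasis_le)
    show "card S \<le> card T" using assms(2) H S T H_eq small by (rule card_negative_eigenbasis_ge)
  qed
  have fin: "finite S" "finite T" using S T by (auto simp: negative_eigenbasis_def orthonormal_def)
  have "T = {} \<longleftrightarrow> S = {}" using card card_0_eq[OF fin(1)] card_0_eq[OF fin(2)] by simp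
  then have "nonneg_operator H \<longleftrightarrow> nonneg_operator V"
    unfolding nonneg_operator_iff_empty[OF H T] nonneg_operator_iff_empty[OF assms(2) S] .
  moreover have "N_minus H = N_minus V"
    unfolding N_minus_eq_card[OF H T] N_minus_eq_card[OF assms(2) S] card ..
  ultimately show ?thesis by blast
qed

end
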